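(* Let $f(x)\in R$ be a monic irreducible polynomial of degree $h$ with nonzero constant coefficient, and let its bound be $f^*=F(x^n)$ with $F(y)\in\mathbb{K}[y]$. Let $\phi_f:R/Rf\to R/Rf$, $v\mapsto xv \bmod_r f$, and let $A_f=C_f\,C_f^{\sigma}\cdots C_f^{\sigma^{n-1}}$ be the matrix of the $\mathbb{L}$-linear map $\phi_f^n$ with respect to the basis $1,x,\dots,x^{h-1}$. Then: (i) the minimal polynomial of $\phi_f^n$ regarded as a $\mathbb{K}$-linear map equals the minimal polynomial of $\phi_f^n$ regarded as an $\mathbb{L}$-linear map; (ii) the characteristic polynomial of $A_f$ is $F(y)^{\ell}$, where $\ell=n/m$ and $m$ is the number of irreducible factors of $F(x^n)$ in $R$. If $\mathbb{K}$ is finite, then $\ell=1$.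
   Context: Let $\mathbb{K}$ be a field, $\mathbb{L}/\mathbb{K}$ a cyclic Galois extension of degree $n\ge 2$, and $\sigma$ a generator of $\mathrm{Gal}(\mathbb{L}/\mathbb{K})$. $R=\mathbb{L}[x;\sigma]$ is the skew polynomial ring of polynomials $\sum a_ix^i$ ($a_i\in\mathbb{L}$) with usual addition and multiplication determined by $xa=\sigma(a)x$ for $a\in\mathbb{L}$; its centre is $\mathbb{K}[x^n]$. $R$ is a left and right Euclidean domain; $g\bmod_r f$ denotes the remainder of right division $g=qf+r$, $\deg r<\deg f$, and $R/Rf$ is identified with polynomials of degree $<\deg f$, a left $\mathbb{L}$-vector space. The bound of a nonconstant $f$ with nonzero constant coefficient is the unique polynomial $F(x^n)$, $F\in\mathbb{K}[y]$ monic, generating the largest two-sided ideal of $R$ contained in $Rf$ (equivalently, the monic central multiple of $f$ of least degree). The map $\phi_f$ is $\sigma$-semilinear, so $\phi_f^n$ ($v\mapsto x^nv\bmod_r f$) is $\mathbb{L}$-linear. $C_f$ is the companion matrix of $f=f_0+\dots+f_{h-1}x^{h-1}+x^h$ (ones on the subdiagonal, last column $(-f_0,\dots,-f_{h-1})^\top$, zeros elsewhere) and $C_f^{\sigma^i}$ is obtained by applying $\sigma^i$ entrywise. *)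

theory Defs
  imports
    "Jordan_Normal_Form.Char_Poly"
    "HOL-Algebra.Ideal"
    "HOL-Algebra.Generated_Groups"
begin

section \<open>Cyclic Galois extensions\<close>

text \<open>A field extension is given by an embedding \<open>\<iota>\<close> of the field \<open>'k\<close> into the field \<open>'l\<close>;
  the subfield \<open>K\<close> of the literature is \<open>range \<iota>\<close>.\<close>

definition galois_group :: "('k::field \<Rightarrow> 'l::field) \<Rightarrow> ('l \<Rightarrow> 'l) monoid" where
  "galois_group \<iota> =
     \<lparr>carrier = {\<tau>. field_hom \<tau> \<and> bij \<tau> \<and> (\<forall>c. \<tau> (\<iota> c) = \<iota> c)}, monoid.mult = (\<circ>), one = id\<rparr>"

definition extension_degree :: "('k::field \<Rightarrow> 'l::field) \<Rightarrow> nat" where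
  "extension_degree \<iota> = vector_space.dim (\<lambda>c v. \<iota> c * v) (UNIV :: 'l set)"

text \<open>The value 0 of \<^const>\<open>extension_degree\<close> stands for infinite degree.\<close>

definition galois_extension :: "('k::field \<Rightarrow> 'l::field) \<Rightarrow> bool" where
  "galois_extension \<iota> \<longleftrightarrow>
     field_hom \<iota> \<and> extension_degree \<iota> > 0 \<and>
     {a. \<forall>\<tau> \<in> carrier (galois_group \<iota>). \<tau> a = a} = range \<iota>"

definition cyclic_galois_extension :: "('k::field \<Rightarrow> 'l::field) \<Rightarrow> nat \<Rightarrow> ('l \<Rightarrow> 'l) \<Rightarrow> bool" where
  "cyclic_galois_extension \<iota> n \<sigma> \<longleftrightarrow>
     galois_extension \<iota> \<and> extension_degree \<iota> = n \<and>
     \<sigma> \<in> carrier (galois_group \<iota>) \<and>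
     generate (galois_group \<iota>) {\<sigma>} = carrier (galois_group \<iota>)"

section \<open>The skew polynomial ring\<close>

text \<open>Skew polynomials are represented by their coefficient sequences, that is by elements of the
  type \<open>'l poly\<close>, with coefficients written on the left of the powers of \<open>x\<close>. Only the
  multiplication differs from that of \<open>'l poly\<close>:
  \<open>(a x\<^sup>i) (b x\<^sup>j) = a \<sigma>\<^sup>i(b) x\<^sup>i\<^sup>+\<^sup>j\<close>.\<close>

definition skew_mult :: "('l::field \<Rightarrow> 'l) \<Rightarrow> 'l poly \<Rightarrow> 'l poly \<Rightarrow> 'l poly" where
  "skew_mult \<sigma> p q =
     (\<Sum>i\<le>degree p. \<Sum>j\<le>degree q. monom (coeff p i * (\<sigma> ^^ i) (coeff q j)) (i + j))"

definition skew_ring :: "('l::field \<Rightarrow> 'l) \<Rightarrow> 'l poly ring" where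
  "skew_ring \<sigma> =
     \<lparr>carrier = UNIV, monoid.mult = skew_mult \<sigma>, one = 1, ring.zero = 0, add = (+)\<rparr>"

text \<open>The constant \<open>irreducible\<close> of HOL-Algebra is tailored to commutative monoids.\<close>

definition skew_irreducible :: "('l::field \<Rightarrow> 'l) \<Rightarrow> 'l poly \<Rightarrow> bool" where
  "skew_irreducible \<sigma> f \<longleftrightarrow>
     f \<noteq> 0 \<and> f \<notin> Units (skew_ring \<sigma>) \<and>
     (\<forall>g h. f = skew_mult \<sigma> g h \<longrightarrow> g \<in> Units (skew_ring \<sigma>) \<or> h \<in> Units (skew_ring \<sigma>))"

text \<open>The number of irreducible factors of a skew polynomial, counted with multiplicity, as a
  relation: \<open>p\<close> is a product of \<open>m\<close> irreducibles.\<close>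

definition skew_num_irreducible_factors :: "('l::field \<Rightarrow> 'l) \<Rightarrow> 'l poly \<Rightarrow> nat \<Rightarrow> bool" where
  "skew_num_irreducible_factors \<sigma> p m \<longleftrightarrow>
     (\<exists>gs. length gs = m \<and> (\<forall>g \<in> set gs. skew_irreducible \<sigma> g) \<and> p = foldr (skew_mult \<sigma>) gs 1)"

text \<open>Since \<open>degree 0 = 0\<close>, the zero polynomial has to be listed separately as a remainder.\<close>

definition skew_remainders :: "'l::field poly \<Rightarrow> 'l poly set" where
  "skew_remainders f = {v. v = 0 \<or> degree v < degree f}"

definition skew_mod :: "('l::field \<Rightarrow> 'l) \<Rightarrow> 'l poly \<Rightarrow> 'l poly \<Rightarrow> 'l poly" where
  "skew_mod \<sigma> g f = (THE r. r \<in> skew_remainders f \<and> (\<exists>q. g = skew_mult \<sigma> q f + r))"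

text \<open>The skew polynomial \<open>F(x\<^sup>n)\<close>.\<close>

definition central_poly :: "('k::field \<Rightarrow> 'l::field) \<Rightarrow> nat \<Rightarrow> 'k poly \<Rightarrow> 'l poly" where
  "central_poly \<iota> n F = (\<Sum>i\<le>degree F. monom (\<iota> (coeff F i)) (n * i))"

text \<open>\<open>F(x\<^sup>n)\<close> is the bound of \<open>f\<close>. In HOL-Algebra \<open>ideal\<close> and \<open>Idl\<close> refer to two-sided ideals,
  whereas \<open>PIdl\<close> consists of left multiples, so that \<open>PIdl\<^bsub>R\<^esub> f\<close> is the left ideal \<open>R f\<close>.\<close>

definition is_bound :: "('k::field \<Rightarrow> 'l::field) \<Rightarrow> nat \<Rightarrow> ('l \<Rightarrow> 'l) \<Rightarrow> 'l poly \<Rightarrow> 'k poly \<Rightarrow> bool" where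
  "is_bound \<iota> n \<sigma> f F \<longleftrightarrow>
     lead_coeff F = 1 \<and>
     Idl\<^bsub>skew_ring \<sigma>\<^esub> {central_poly \<iota> n F} \<subseteq> PIdl\<^bsub>skew_ring \<sigma>\<^esub> f \<and>
     (\<forall>I. ideal I (skew_ring \<sigma>) \<and> I \<subseteq> PIdl\<^bsub>skew_ring \<sigma>\<^esub> f
        \<longrightarrow> I \<subseteq> Idl\<^bsub>skew_ring \<sigma>\<^esub> {central_poly \<iota> n F})"

definition phi :: "('l::field \<Rightarrow> 'l) \<Rightarrow> 'l poly \<Rightarrow> 'l poly \<Rightarrow> 'l poly" where
  "phi \<sigma> f v = skew_mod \<sigma> (skew_mult \<sigma> (monom 1 1) v) f"

section \<open>Minimal polynomials\<close>

definition poly_map_apply ::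
    "('a::field \<Rightarrow> 'v::ab_group_add \<Rightarrow> 'v) \<Rightarrow> 'a poly \<Rightarrow> ('v \<Rightarrow> 'v) \<Rightarrow> 'v \<Rightarrow> 'v" where
  "poly_map_apply scale p T v = (\<Sum>i\<le>degree p. scale (coeff p i) ((T ^^ i) v))"

text \<open>The minimal polynomial of the linear endomorphism \<open>T\<close> of the subspace \<open>V\<close>, for the scalar
  multiplication \<open>scale\<close>.\<close>

definition min_poly ::
    "('a::field \<Rightarrow> 'v::ab_group_add \<Rightarrow> 'v) \<Rightarrow> 'v set \<Rightarrow> ('v \<Rightarrow> 'v) \<Rightarrow> 'a poly" where
  "min_poly scale V T =
     (THE p. lead_coeff p = 1 \<and> (\<forall>v\<in>V. poly_map_apply scale p T v = 0) \<and>
        (\<forall>q. q \<noteq> 0 \<and> (\<forall>v\<in>V. poly_map_apply scale q T v = 0) \<longrightarrow> degree p \<le> degree q))"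

section \<open>Matrices\<close>

definition companion_matrix :: "'l::field poly \<Rightarrow> 'l mat" where
  "companion_matrix f =
     mat (degree f) (degree f)
       (\<lambda>(i, j). if j = degree f - 1 then - coeff f i else if i = j + 1 then 1 else 0)"

text \<open>\<open>C\<^sub>f C\<^sub>f\<^sup>\<sigma> \<cdots> C\<^sub>f\<^sup>\<tau>\<close> for \<open>\<tau> = \<sigma>\<^sup>n\<^sup>-\<^sup>1\<close>, multiplied in this order.\<close>

definition A_mat :: "nat \<Rightarrow> ('l::field \<Rightarrow> 'l) \<Rightarrow> 'l poly \<Rightarrow> 'l mat" where
  "A_mat n \<sigma> f =
     foldr (*) (map (\<lambda>i. map_mat (\<sigma> ^^ i) (companion_matrix f)) [0..<n]) (1\<^sub>m (degree f))"

text \<open>The matrix, with respect to the basis \<open>1, x, \<dots>, x\<^sup>h\<^sup>-\<^sup>1\<close>, of a linear map on the polynomials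
  of degree less than \<open>h\<close>; column \<open>j\<close> is the image of \<open>x\<^sup>j\<close>.\<close>

definition matrix_of_map :: "nat \<Rightarrow> ('l::field poly \<Rightarrow> 'l poly) \<Rightarrow> 'l mat" where
  "matrix_of_map h T = mat h h (\<lambda>(i, j). coeff (T (monom 1 j)) i)"

end

theory Submission
  imports Defs
begin

text \<open>
  Let \<open>R\<close> be the skew polynomial ring and \<open>M = R / R f\<close>. As \<open>f\<close> is irreducible, \<open>M\<close> is simple, and its
  annihilator is generated by \<open>F(x\<^sup>n)\<close>. A polynomial \<open>q\<close> over the large field kills \<open>\<phi>\<^sup>n\<close> iff
  \<open>q(x\<^sup>n)\<close> annihilates \<open>M\<close>, so both minimal polynomials are \<open>F\<close>, and \<open>F\<close> is irreducible.

  If an irreducible \<open>g\<close> divides \<open>F(x\<^sup>n) = q g = g q\<close>, then \<open>g\<close> is not injective on \<open>M\<close>, for otherwise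
  \<open>q\<close> would annihilate \<open>M\<close>. Hence \<open>R / R g\<close> is isomorphic to \<open>M\<close> and \<open>deg g = deg f\<close>, which gives
  \<open>m deg f = n deg F\<close>.

  The companion matrix conjugates \<open>A\<close> into \<open>A\<^sup>\<sigma>\<close>, so its characteristic polynomial has coefficients in
  the small field. It divides \<open>det (F(y) I - F(A)) = F(y)\<^sup>d\<close> where \<open>d = deg f\<close>, so it equals \<open>F\<^sup>k\<close> with
  \<open>deg f = k deg F\<close>; comparing degrees gives \<open>n = m k\<close>.

  Over a finite field let \<open>S\<close> be the quotient of the polynomial ring \<open>L[y]\<close> by \<open>F\<close>. Hilbert 90 for the units of \<open>S\<close> and
  counting show that the norm of \<open>S\<close> attains the value \<open>y\<close>, at \<open>c\<close> say. Letting \<open>x\<close> act on \<open>S\<close> as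
  \<open>s \<mapsto> c \<sigma>(s)\<close> makes \<open>S\<close> an \<open>R\<close>-module killed by \<open>F(x\<^sup>n)\<close>, so that some divisor of \<open>F(x\<^sup>n)\<close> of
  positive degree has degree at most \<open>deg F\<close>. Therefore \<open>deg f \<le> deg F\<close> and \<open>k = 1\<close>.
\<close>

section \<open>Skew polynomials over a field\<close>

text \<open>Additive statements reduce to monomials, where the skew product is explicit.
  \<open>0\<close> is itself a monomial with coefficient \<open>0\<close>, so it has no case of its
  own.\<close>

lemma poly_monom_induct [case_names add monom]:
  fixes p :: "'a::comm_monoid_add poly"
  assumes add: "\<And>p q. P p \<Longrightarrow> P q \<Longrightarrow> P (p + q)" and monom: "\<And>a i. P (monom a i)"
  shows "P p"
proof -
  have "P (\<Sum>i\<le>n. monom (coeff p i) i)" for n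
    by (induction n) (auto intro: add monom)
  then show ?thesis by (metis poly_as_sum_of_monoms)
qed

locale skew_poly = field_hom \<sigma> for \<sigma> :: "'l::field \<Rightarrow> 'l"
begin

abbreviation smul :: "'l poly \<Rightarrow> 'l poly \<Rightarrow> 'l poly" (infixl "\<star>" 70)
  where "p \<star> q \<equiv> skew_mult \<sigma> p q"

lemma field_hom_funpow: "field_hom (\<sigma> ^^ i)"
  by (unfold_locales; induction i) (simp_all add: hom_add hom_mult)

lemma funpow_simps [simp]:
  "(\<sigma> ^^ i) 0 = 0" "(\<sigma> ^^ i) 1 = 1" "(\<sigma> ^^ i) (a + b) = (\<sigma> ^^ i) a + (\<sigma> ^^ i) b"
  "(\<sigma> ^^ i) (a * b) = (\<sigma> ^^ i) a * (\<sigma> ^^ i) b" "(\<sigma> ^^ i) (- a) = - (\<sigma> ^^ i) a"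
  "(\<sigma> ^^ i) (a - b) = (\<sigma> ^^ i) a - (\<sigma> ^^ i) b" "(\<sigma> ^^ i) (a / b) = (\<sigma> ^^ i) a / (\<sigma> ^^ i) b"
  "(\<sigma> ^^ i) a = 0 \<longleftrightarrow> a = 0"
proof -
  interpret h: field_hom "\<sigma> ^^ i" by (rule field_hom_funpow)
  show "(\<sigma> ^^ i) 0 = 0" "(\<sigma> ^^ i) 1 = 1" "(\<sigma> ^^ i) (a + b) = (\<sigma> ^^ i) a + (\<sigma> ^^ i) b"
    "(\<sigma> ^^ i) (a * b) = (\<sigma> ^^ i) a * (\<sigma> ^^ i) b" "(\<sigma> ^^ i) (- a) = - (\<sigma> ^^ i) a"
    "(\<sigma> ^^ i) (a - b) = (\<sigma> ^^ i) a - (\<sigma> ^^ i) b" "(\<sigma> ^^ i) (a / b) = (\<sigma> ^^ i) a / (\<sigma> ^^ i) b"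
    "(\<sigma> ^^ i) a = 0 \<longleftrightarrow> a = 0"
    by (simp_all add: h.hom_add h.hom_mult h.hom_uminus h.hom_minus h.hom_div)
qed

lemma funpow_sum: "(\<sigma> ^^ i) (sum g A) = (\<Sum>a\<in>A. (\<sigma> ^^ i) (g a))"
  by (induction A rule: infinite_finite_induct) auto

section \<open>Coefficients, ring laws and degrees of skew products\<close>

lemma coeff_skew_mult: "coeff (p \<star> q) k = (\<Sum>i\<le>k. coeff p i * (\<sigma> ^^ i) (coeff q (k - i)))"
proof -
  \<comment> \<open>Both sums are padded with zeros up to \<open>N\<close>; for fixed
    \<open>i\<close> only \<open>j = k - i\<close> survives, and the guard \<open>i \<le> k\<close>
    excludes truncated differences.\<close>
  define N where "N = max k (max (degree p) (degree q))"
  have "coeff (p \<star> q) k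
      = (\<Sum>i\<le>degree p. \<Sum>j\<le>degree q. if i + j = k then coeff p i * (\<sigma> ^^ i) (coeff q j) else 0)"
    by (simp add: skew_mult_def coeff_sum cong: if_cong)
  also have "\<dots> = (\<Sum>i\<le>degree p. \<Sum>j\<le>N. if i + j = k then coeff p i * (\<sigma> ^^ i) (coeff q j) else 0)"
    by (intro sum.cong refl sum.mono_neutral_left) (auto simp: N_def coeff_eq_0)
  also have "\<dots> = (\<Sum>i\<le>N. \<Sum>j\<le>N. if i + j = k then coeff p i * (\<sigma> ^^ i) (coeff q j) else 0)"
    by (intro sum.mono_neutral_left) (auto simp: N_def coeff_eq_0 intro!: sum.neutral)
  also have "\<dots> = (\<Sum>i\<le>N. if i \<le> k then coeff p i * (\<sigma> ^^ i) (coeff q (k - i)) else 0)"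
  proof (intro sum.cong refl)
    fix i
    have "(\<Sum>j\<le>N. if i + j = k then coeff p i * (\<sigma> ^^ i) (coeff q j) else 0)
       = (\<Sum>j\<le>N. if j = k - i then (if i \<le> k then coeff p i * (\<sigma> ^^ i) (coeff q j) else 0) else 0)"
      by (intro sum.cong refl) auto
    also have "\<dots> = (if i \<le> k then coeff p i * (\<sigma> ^^ i) (coeff q (k - i)) else 0)"
      by (subst sum.delta) (auto simp: N_def)
    finally show "(\<Sum>j\<le>N. if i + j = k then coeff p i * (\<sigma> ^^ i) (coeff q j) else 0) = \<dots>" .
  qed
  also have "\<dots> = (\<Sum>i\<le>k. coeff p i * (\<sigma> ^^ i) (coeff q (k - i)))"
    by (intro sum.mono_neutral_cong_right) (auto simp: N_def)
  finally show ?thesis .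
qed

lemma coeff_skew_mult_0: "coeff (p \<star> q) 0 = coeff p 0 * coeff q 0"
  by (simp add: coeff_skew_mult)

lemma skew_mult_distrib:
  "(p + p') \<star> q = p \<star> q + p' \<star> q" "p \<star> (q + q') = p \<star> q + p \<star> q'"
  by (auto intro!: poly_eqI simp: coeff_skew_mult algebra_simps sum.distrib)

lemma skew_mult_diff:
  "(p - p') \<star> q = p \<star> q - p' \<star> q" "p \<star> (q - q') = p \<star> q - p \<star> q'"
  by (auto intro!: poly_eqI simp: coeff_skew_mult algebra_simps sum_subtractf)

lemma skew_mult_0 [simp]: "0 \<star> q = 0" "p \<star> 0 = 0"
  by (auto intro!: poly_eqI simp: coeff_skew_mult)

lemma skew_mult_monom: "monom a i \<star> monom b j = monom (a * (\<sigma> ^^ i) b) (i + j)"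
proof -
  have "(\<Sum>i'\<le>k. (if i = i' then a else 0) * (\<sigma> ^^ i') (if j = k - i' then b else 0)) =
     (\<Sum>i'\<le>k. if i = i' then a * (\<sigma> ^^ i) (if j = k - i then b else 0) else 0)" for k
    by (intro sum.cong) auto
  then show ?thesis
    by (auto intro!: poly_eqI simp: coeff_skew_mult)
qed

lemma skew_mult_assoc: "p \<star> q \<star> r = p \<star> (q \<star> r)"
proof (induction p rule: poly_monom_induct)
  case (monom a i)
  show ?case
  proof (induction q rule: poly_monom_induct)
    case (monom b j)
    show ?case
      by (induction r rule: poly_monom_induct)
        (simp_all add: skew_mult_distrib skew_mult_monom funpow_add add.assoc mult.assoc)
  qed (simp add: skew_mult_distrib)
qed (simp add: skew_mult_distrib)

lemma const_skew_mult: "[:a:] \<star> p = Polynomial.smult a p"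
  by (induction p rule: poly_monom_induct)
    (simp_all add: skew_mult_distrib skew_mult_monom smult_add_right smult_monom flip: monom_0)

lemma monom_1_skew_mult: "monom 1 1 \<star> p = pCons 0 (map_poly \<sigma> p)"
  by (induction p rule: poly_monom_induct)
    (simp_all add: skew_mult_distrib skew_mult_monom map_poly_hom_add map_poly_monom, simp add: monom_Suc)

lemma skew_mult_1 [simp]: "1 \<star> p = p" "p \<star> 1 = p"
proof -
  show "1 \<star> p = p" using const_skew_mult[of 1 p] by (simp flip: one_pCons)
  show "p \<star> 1 = p"
    by (induction p rule: poly_monom_induct)
      (simp_all add: skew_mult_distrib skew_mult_monom flip: monom_eq_1)
qed

lemma smult_skew_mult: "Polynomial.smult a p \<star> q = Polynomial.smult a (p \<star> q)"
  by (simp add: skew_mult_assoc flip: const_skew_mult)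

lemma coeff_skew_mult_degree:
  "coeff (p \<star> q) (degree p + degree q) = lead_coeff p * (\<sigma> ^^ degree p) (lead_coeff q)"
proof -
  have "(\<Sum>i\<le>degree p + degree q. coeff p i * (\<sigma> ^^ i) (coeff q (degree p + degree q - i))) =
     (\<Sum>i\<in>{degree p}. coeff p i * (\<sigma> ^^ i) (coeff q (degree p + degree q - i)))"
  proof (intro sum.mono_neutral_right ballI)
    fix i assume "i \<in> {..degree p + degree q} - {degree p}"
    then have "degree p < i \<or> degree q < degree p + degree q - i" by auto
    then show "coeff p i * (\<sigma> ^^ i) (coeff q (degree p + degree q - i)) = 0"
      by (auto simp: coeff_eq_0)
  qed auto
  then show ?thesis by (simp add: coeff_skew_mult)
qed

lemma degree_skew_mult_le: "degree (p \<star> q) \<le> degree p + degree q"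
proof (rule degree_le, intro allI impI)
  fix k assume "degree p + degree q < k"
  then have "degree p < i \<or> degree q < k - i" for i by linarith
  then show "coeff (p \<star> q) k = 0"
    unfolding coeff_skew_mult by (intro sum.neutral ballI) (metis coeff_eq_0 funpow_simps(1) mult_eq_0_iff)
qed

lemma skew_mult_eq_0_iff [simp]: "p \<star> q = 0 \<longleftrightarrow> p = 0 \<or> q = 0"
  using coeff_skew_mult_degree[of p q] by auto

lemma degree_skew_mult: "p \<noteq> 0 \<Longrightarrow> q \<noteq> 0 \<Longrightarrow> degree (p \<star> q) = degree p + degree q"
  using coeff_skew_mult_degree[of p q] degree_skew_mult_le[of p q]
  by (intro antisym le_degree) auto

lemma skew_mult_cancel: "p \<star> q = p' \<star> q \<Longrightarrow> q \<noteq> 0 \<Longrightarrow> p = p'"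
  using skew_mult_diff(1)[of p p' q] by auto

lemma skew_mult_cancel_left: "p \<star> q = p \<star> q' \<Longrightarrow> p \<noteq> 0 \<Longrightarrow> q = q'"
  using skew_mult_diff(2)[of p q q'] by auto

section \<open>Right division, principal left ideals and Bezout identities\<close>

lemma skew_right_division:
  assumes "f \<noteq> 0"
  shows "\<exists>q r. g = q \<star> f + r \<and> r \<in> skew_remainders f"
proof (induction "degree g" arbitrary: g rule: less_induct)
  case less
  show ?case
  proof (cases "g \<in> skew_remainders f")
    case True
    then show ?thesis by (metis add_0 skew_mult_0(1))
  next
    case False
    then have g: "g \<noteq> 0" "degree f \<le> degree g" by (auto simp: skew_remainders_def)
    define k where "k = degree g - degree f"
    \<comment> \<open>Moving \<open>x\<^sup>k\<close> past the leading coefficient of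
      \<open>f\<close> applies \<open>\<sigma>\<^sup>k\<close> to it, hence this
      denominator.\<close>
    define t where "t = monom (lead_coeff g / (\<sigma> ^^ k) (lead_coeff f)) k"
    have t: "degree t = k" "t \<noteq> 0" using g assms by (auto simp: t_def degree_monom_eq)
    have deg: "degree (t \<star> f) = degree g" using degree_skew_mult[of t f] t assms g by (simp add: k_def)
    have "coeff (t \<star> f) (degree g) = lead_coeff g"
      using coeff_skew_mult_degree[of t f] t g assms by (simp add: k_def t_def)
    then have c: "coeff (g - t \<star> f) (degree g) = 0" by simp
    show ?thesis
    proof (cases "degree g = 0")
      case True
      then have "g - t \<star> f = 0" using c deg
        by (metis coeff_0 degree_diff_le leading_coeff_0_iff le_zero_eq)
      then show ?thesis by (intro exI[of _ t] exI[of _ 0]) (auto simp: skew_remainders_def)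
    next
      case False
      then have "degree (g - t \<star> f) < degree g"
        using c deg by (metis degree_diff_le degree_0 leading_coeff_0_iff le_neq_implies_less not_gr_zero order_refl)
      from less[OF this] obtain q r where "g - t \<star> f = q \<star> f + r" "r \<in> skew_remainders f" by auto
      then show ?thesis
        by (intro exI[of _ "t + q"] exI[of _ r]) (auto simp: skew_mult_distrib algebra_simps)
    qed
  qed
qed

lemma skew_remainders_diff: "u \<in> skew_remainders f \<Longrightarrow> v \<in> skew_remainders f \<Longrightarrow> u - v \<in> skew_remainders f"
  by (auto simp: skew_remainders_def intro: degree_diff_less)

lemma skew_remainder_multiple_eq_0:
  assumes "q \<star> f \<in> skew_remainders f"
  shows "q \<star> f = 0"
proof (rule ccontr)
  assume "q \<star> f \<noteq> 0"
  then have "degree (q \<star> f) \<ge> degree f" by (simp add: degree_skew_mult)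
  with assms \<open>q \<star> f \<noteq> 0\<close> show False by (auto simp: skew_remainders_def)
qed

lemma skew_mod_eqI:
  assumes "r \<in> skew_remainders f" "g = q \<star> f + r"
  shows "skew_mod \<sigma> g f = r"
  unfolding skew_mod_def
proof (rule the_equality)
  fix r' assume r': "r' \<in> skew_remainders f \<and> (\<exists>q. g = q \<star> f + r')"
  then obtain q' where "g = q' \<star> f + r'" by auto
  with assms have "(q' - q) \<star> f = r - r'" by (simp add: skew_mult_diff algebra_simps)
  then show "r' = r"
    using skew_remainder_multiple_eq_0 skew_remainders_diff assms(1) r' by (metis right_minus_eq)
qed (use assms in auto)

text \<open>A nonzero element of least degree, made monic, generates: the remainder on division by
  it stays in \<open>I\<close> and must vanish. Subtraction is obtained from left multiplication by
  the constant \<open>-1\<close>.\<close>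

lemma left_ideal_principal:
  assumes "p \<in> I" "p \<noteq> 0"
    and add: "\<And>u v. u \<in> I \<Longrightarrow> v \<in> I \<Longrightarrow> u + v \<in> I"
    and mult: "\<And>u v. v \<in> I \<Longrightarrow> u \<star> v \<in> I"
  obtains d where "d \<in> I" "lead_coeff d = 1" "degree d \<le> degree p" "\<And>u. u \<in> I \<longleftrightarrow> (\<exists>q. u = q \<star> d)"
proof -
  obtain d where d: "d \<in> I" "d \<noteq> 0" and min: "\<And>u. u \<in> I \<Longrightarrow> u \<noteq> 0 \<Longrightarrow> degree d \<le> degree u"
    using ex_has_least_nat[of "\<lambda>u. u \<in> I \<and> u \<noteq> 0" p degree] assms(1,2) by auto
  define d' where "d' = [:inverse (lead_coeff d):] \<star> d"
  have d': "d' \<in> I" "lead_coeff d' = 1" "degree d' = degree d"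
    using d mult[OF d(1)] by (auto simp: d'_def) (simp_all add: const_skew_mult)
  then have "d' \<noteq> 0" by auto
  show thesis
  proof (rule that[OF d'(1,2)])
    show "degree d' \<le> degree p" using min[OF assms(1,2)] d' by simp
    fix u
    show "u \<in> I \<longleftrightarrow> (\<exists>q. u = q \<star> d')"
    proof
      assume "u \<in> I"
      obtain q r where qr: "u = q \<star> d' + r" "r \<in> skew_remainders d'"
        using skew_right_division[OF \<open>d' \<noteq> 0\<close>] by blast
      have "r = u + [:-1:] \<star> (q \<star> d')" using qr by (simp add: const_skew_mult)
      then have "r \<in> I" using \<open>u \<in> I\<close> d'(1) by (metis add mult)
      then have "r = 0" using min[of r] qr(2) d'(3) by (cases "r = 0") (auto simp: skew_remainders_def)
      then show "\<exists>q. u = q \<star> d'" using qr by auto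
    qed (auto intro: mult d')
  qed
qed

lemma Units_skew_ring: "Units (skew_ring \<sigma>) = {p. p \<noteq> 0 \<and> degree p = 0}"
proof (intro Set.set_eqI iffI)
  fix p assume "p \<in> Units (skew_ring \<sigma>)"
  then obtain q where "q \<star> p = 1" by (auto simp: Units_def skew_ring_def)
  moreover from this have "q \<noteq> 0" "p \<noteq> 0" by auto
  ultimately show "p \<in> {p. p \<noteq> 0 \<and> degree p = 0}"
    using degree_skew_mult[of q p] by auto
next
  fix p :: "'l poly" assume "p \<in> {p. p \<noteq> 0 \<and> degree p = 0}"
  then obtain a where "p = [:a:]" "a \<noteq> 0" by (auto elim: degree_eq_zeroE)
  then show "p \<in> Units (skew_ring \<sigma>)"
    by (auto simp: Units_def skew_ring_def const_skew_mult intro!: exI[of _ "[:inverse a:]"])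
qed

lemma skew_irreducible_iff:
  "skew_irreducible \<sigma> f \<longleftrightarrow>
     degree f > 0 \<and> (\<forall>g h. f = g \<star> h \<longrightarrow> degree g = 0 \<or> degree h = 0)"
  unfolding skew_irreducible_def Units_skew_ring by (auto, (metis skew_mult_eq_0_iff neq0_conv degree_0)+)

text \<open>Maximality of the left ideal \<open>R f\<close>: the generator \<open>d\<close> of
  \<open>R u + R f\<close> is a right factor of \<open>f\<close>. If the cofactor were constant,
  \<open>u\<close> would be a left multiple of \<open>f\<close>, so \<open>d\<close> is
  constant.\<close>

lemma skew_irreducible_bezout:
  assumes "skew_irreducible \<sigma> f" "\<nexists>q. u = q \<star> f"
  shows "\<exists>a b. a \<star> u + b \<star> f = 1"
proof -
  have f: "f \<noteq> 0" "degree f > 0" using assms(1) by (auto simp: skew_irreducible_iff)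
  define I where "I = {a \<star> u + b \<star> f | a b. True}"
  have "f \<in> I" "u \<in> I" unfolding I_def by (auto, metis add_0 skew_mult_0(1) skew_mult_1(1), metis add.right_neutral skew_mult_0(1) skew_mult_1(1))
  obtain d where d: "d \<in> I" "\<And>u. u \<in> I \<longleftrightarrow> (\<exists>q. u = q \<star> d)"
  proof (rule left_ideal_principal[of f I])
    fix v w assume "v \<in> I" "w \<in> I"
    then obtain a b a' b' where "v = a \<star> u + b \<star> f" "w = a' \<star> u + b' \<star> f" by (auto simp: I_def)
    then have "v + w = (a + a') \<star> u + (b + b') \<star> f" by (simp add: skew_mult_distrib)
    then show "v + w \<in> I" by (auto simp: I_def)
  next
    fix v w assume "w \<in> I"
    then obtain a b where "w = a \<star> u + b \<star> f" by (auto simp: I_def)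
    then have "v \<star> w = (v \<star> a) \<star> u + (v \<star> b) \<star> f" by (simp add: skew_mult_distrib skew_mult_assoc)
    then show "v \<star> w \<in> I" by (auto simp: I_def)
  qed (use \<open>f \<in> I\<close> f in auto)
  from \<open>f \<in> I\<close> d obtain q where q: "f = q \<star> d" by auto
  have unit: "\<exists>c'. c' \<star> c = 1" if "degree c = 0" "c \<noteq> 0" for c
    using that Units_skew_ring by (auto simp: Units_def skew_ring_def)
  have "q \<noteq> 0" "d \<noteq> 0" using q f by auto
  have "degree q \<noteq> 0"
  proof
    assume "degree q = 0"
    then obtain c where "c \<star> q = 1" using unit \<open>q \<noteq> 0\<close> by blast
    then have "d = c \<star> f" using q by (simp flip: skew_mult_assoc)
    moreover obtain s where "u = s \<star> d" using d \<open>u \<in> I\<close> by auto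
    ultimately show False using assms(2) by (metis skew_mult_assoc)
  qed
  then have "degree d = 0" using assms(1) q unfolding skew_irreducible_iff by metis
  then have "1 \<in> I" using d(2) unit \<open>d \<noteq> 0\<close> by metis
  then show ?thesis by (auto simp: I_def)
qed

text \<open>If \<open>f u = w g\<close> with \<open>R u + R g = R\<close>, then \<open>r \<mapsto> r u\<close> induces a surjection
  \<open>R / R f \<rightarrow> R / R g\<close>.\<close>

lemma degree_le_of_surjection:
  assumes "f \<star> u = w \<star> g" "f \<noteq> 0" "a \<star> u + b \<star> g = 1"
  shows "degree g \<le> degree f"
  using assms
proof (induction "degree u" arbitrary: f u w g a b rule: less_induct)
  case less
  have red: "degree g \<le> degree f"
    if uw: "f \<star> u = w \<star> g" "f \<noteq> 0" "a \<star> u + b \<star> g = 1" "u \<noteq> 0"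
     and IH: "\<And>f' u' w' g' a' b'. degree u' < degree u \<Longrightarrow>  f' \<star> u' = w' \<star> g' \<Longrightarrow> f' \<noteq> 0
       \<Longrightarrow> a' \<star> u' + b' \<star> g' = 1 \<Longrightarrow> degree g' \<le> degree f'" for f u w g a b
  proof -
    have [simp]: "w \<noteq> 0" "g \<noteq> 0" using uw by auto
    obtain q r where g: "g = q \<star> u + r" and r: "r \<in> skew_remainders u"
      using skew_right_division[OF \<open>u \<noteq> 0\<close>] by blast
    \<comment> \<open>The hypotheses recur with \<open>w\<close>, \<open>r\<close>, \<open>u\<close>
      in the roles of \<open>f\<close>, \<open>u\<close>, \<open>g\<close>. The smaller instance
      gives \<open>degree u \<le> degree w\<close>, and comparing degrees in
      \<open>f \<star> u = w \<star> g\<close> finishes.\<close>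
    have 1: "w \<star> r = (f - w \<star> q) \<star> u"
      using uw(1) g by (simp add: skew_mult_distrib skew_mult_diff skew_mult_assoc)
    have 2: "b \<star> r + (a + b \<star> q) \<star> u = 1"
      using uw(3) g by (simp add: skew_mult_distrib skew_mult_assoc ac_simps)
    have "degree u \<le> degree w"
    proof (cases "r = 0")
      case True
      with 2 have "(a + b \<star> q) \<star> u = 1" by simp
      then have "degree u = 0"
        by (metis Units_skew_ring degree_1 degree_skew_mult mult_eq_0_iff add_is_0 skew_mult_eq_0_iff zero_neq_one)
      then show ?thesis by simp
    next
      case False
      then show ?thesis using IH[OF _ 1 \<open>w \<noteq> 0\<close> 2] r by (auto simp: skew_remainders_def)
    qed
    moreover have "degree f + degree u = degree w + degree g"
      using uw degree_skew_mult by (metis \<open>w \<noteq> 0\<close> \<open>g \<noteq> 0\<close>)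
    ultimately show ?thesis by linarith
  qed
  show ?case
  proof (cases "u = 0")
    case True
    then have "b \<star> g = 1" using less.prems by simp
    then have "degree g = 0"
      by (metis degree_1 degree_skew_mult add_is_0 skew_mult_eq_0_iff zero_neq_one)
    then show ?thesis by simp
  next
    case False
    show ?thesis using red[OF less.prems False] less.hyps by blast
  qed
qed

text \<open>The left Ore condition with a degree bound. In the Euclidean step \<open>g\<close> and
  the remainder \<open>u'\<close> exchange roles, and \<open>w \<star> g = r \<star> u'\<close>
  turns the bound on \<open>w\<close> into one on \<open>r\<close>.\<close>

lemma ex_left_multiple:
  assumes "g \<noteq> 0"
  shows "\<exists>r w. r \<noteq> 0 \<and> degree r \<le> degree g \<and> r \<star> u = w \<star> g"
  using assms
proof (induction "degree g" arbitrary: g u rule: less_induct)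
  case less
  obtain q u' where u: "u = q \<star> g + u'" and u': "u' \<in> skew_remainders g"
    using skew_right_division[OF less.prems] by blast
  show ?case
  proof (cases "u' = 0")
    case True
    then show ?thesis using u by (intro exI[of _ 1] exI[of _ q]) auto
  next
    case False
    then obtain w r where w: "w \<noteq> 0" "degree w \<le> degree u'" "w \<star> g = r \<star> u'"
      using less.hyps[of u' g] u' by (auto simp: skew_remainders_def)
    then have "r \<noteq> 0" using less.prems by auto
    moreover have "degree r + degree u' = degree w + degree g"
      using w degree_skew_mult \<open>r \<noteq> 0\<close> False less.prems by metis
    moreover have "r \<star> u = (r \<star> q + w) \<star> g"
      using w(3) by (simp add: u skew_mult_distrib skew_mult_assoc)
    ultimately show ?thesis using w(2) by (intro exI[of _ r] exI[of _ "r \<star> q + w"]) auto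
  qed
qed

lemma ring_skew_ring: "ring (skew_ring \<sigma>)"
proof (rule ringI)
  show "abelian_group (skew_ring \<sigma>)"
    by (rule abelian_groupI) (auto simp: skew_ring_def intro: exI[of _ "- _"] left_minus)
  show "Group.monoid (skew_ring \<sigma>)"
    by (rule monoidI) (auto simp: skew_ring_def skew_mult_assoc)
qed (auto simp: skew_ring_def skew_mult_distrib)

section \<open>Skew polynomials as operators on the field\<close>

text \<open>The field as a module over the skew polynomial ring, with \<open>x\<close> acting as
  \<open>\<sigma>\<close>; products become compositions.\<close>

definition skew_eval :: "'l poly \<Rightarrow> 'l \<Rightarrow> 'l" where
  "skew_eval p a = (\<Sum>i\<le>degree p. coeff p i * (\<sigma> ^^ i) a)"

lemma skew_eval_bound: "degree p \<le> N \<Longrightarrow> skew_eval p a = (\<Sum>i\<le>N. coeff p i * (\<sigma> ^^ i) a)"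
  unfolding skew_eval_def by (intro sum.mono_neutral_left) (auto simp: coeff_eq_0)

lemma skew_eval_add: "skew_eval (p + q) a = skew_eval p a + skew_eval q a"
proof -
  define N where "N = max (degree p) (degree q)"
  have "degree (p + q) \<le> N" "degree p \<le> N" "degree q \<le> N"
    by (auto simp: N_def degree_add_le)
  then show ?thesis by (simp add: skew_eval_bound algebra_simps sum.distrib)
qed

lemma skew_eval_monom: "skew_eval (monom c i) a = c * (\<sigma> ^^ i) a"
proof -
  have "skew_eval (monom c i) a = (\<Sum>j\<le>i. if i = j then c * (\<sigma> ^^ i) a else 0)"
    unfolding skew_eval_bound[OF degree_monom_le] by (intro sum.cong) auto
  then show ?thesis by simp
qed

lemma skew_eval_const: "skew_eval [:c:] a = c * a"
  by (simp add: skew_eval_def)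

lemma skew_eval_linear: "skew_eval [:c, 1:] a = c * a + \<sigma> a"
  by (simp add: skew_eval_def)

lemma skew_eval_add_right: "skew_eval p (a + b) = skew_eval p a + skew_eval p b"
  by (simp add: skew_eval_def algebra_simps sum.distrib)

lemma skew_eval_0_right [simp]: "skew_eval p 0 = 0"
  by (simp add: skew_eval_def)

lemma skew_eval_diff: "skew_eval (p - q) a = skew_eval p a - skew_eval q a"
  using skew_eval_add[of "p - q" q a] by simp

lemma skew_eval_mult: "skew_eval (p \<star> q) a = skew_eval p (skew_eval q a)"
proof (induction p rule: poly_monom_induct)
  case (monom c i)
  show ?case
    by (induction q rule: poly_monom_induct)
      (simp_all add: skew_mult_distrib skew_mult_monom skew_eval_add skew_eval_add_right
        skew_eval_monom funpow_add)
qed (simp add: skew_mult_distrib skew_eval_add)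

text \<open>Each new point costs one linear left factor: if \<open>v\<close> is the value there,
  \<open>x - \<sigma>(v) / v\<close> kills \<open>v\<close>.\<close>

lemma ex_skew_eval_annihilator:
  "\<exists>p. p \<noteq> 0 \<and> degree p \<le> t \<and> (\<forall>j<t. skew_eval p (b j) = 0)"
proof (induction t)
  case 0
  then show ?case by (intro exI[of _ 1]) auto
next
  case (Suc t)
  then obtain p where p: "p \<noteq> 0" "degree p \<le> t" "\<forall>j<t. skew_eval p (b j) = 0" by auto
  define v where "v = skew_eval p (b t)"
  define l where "l = (if v = 0 then 1 else [:- (\<sigma> v / v), 1:])"
  have l: "l \<noteq> 0" "degree l \<le> 1" "skew_eval l v = 0"
    by (auto simp: l_def skew_eval_linear)
  have "degree (l \<star> p) \<le> Suc t" using degree_skew_mult_le[of l p] l p by linarith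
  moreover have "skew_eval (l \<star> p) (b j) = 0" if "j < Suc t" for j
    using that p(3) l(3) by (auto simp: skew_eval_mult v_def less_Suc_eq)
  ultimately show ?case using l(1) p(1) by (intro exI[of _ "l \<star> p"]) auto
qed

end

section \<open>Cyclic extensions\<close>

lemma galois_group_group:
  fixes \<iota> :: "'k::field \<Rightarrow> 'l::field"
  shows "group (galois_group \<iota>)"
proof (rule groupI)
  fix \<tau> assume \<tau>: "\<tau> \<in> carrier (galois_group \<iota>)"
  then interpret h: field_hom \<tau> by (simp add: galois_group_def)
  interpret h: field_isom \<tau>
    by unfold_locales (use \<tau> in \<open>auto simp: galois_group_def dest: bij_is_surj\<close>)
  have "inv_into UNIV \<tau> \<in> carrier (galois_group \<iota>)"
    using \<tau> h.inv.field_hom_axioms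
    by (auto simp: galois_group_def bij_imp_bij_inv inv_f_eq bij_is_inj)
  moreover have "inv_into UNIV \<tau> \<circ> \<tau> = id" using \<tau> by (simp add: galois_group_def bij_is_inj)
  ultimately show "\<exists>y\<in>carrier (galois_group \<iota>). y \<otimes>\<^bsub>galois_group \<iota>\<^esub> \<tau> = \<one>\<^bsub>galois_group \<iota>\<^esub>"
    by (intro bexI[of _ "inv_into UNIV \<tau>"]) (simp_all add: galois_group_def)
next
  fix \<tau> \<rho> assume *: "\<tau> \<in> carrier (galois_group \<iota>)" "\<rho> \<in> carrier (galois_group \<iota>)"
  then interpret h: field_hom \<tau> by (simp add: galois_group_def)
  from * interpret g: field_hom \<rho> by (simp add: galois_group_def)
  have "field_hom (\<tau> \<circ> \<rho>)" by unfold_locales (auto simp: h.hom_add g.hom_add h.hom_mult g.hom_mult)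
  then show "\<tau> \<otimes>\<^bsub>galois_group \<iota>\<^esub> \<rho> \<in> carrier (galois_group \<iota>)"
    using * by (auto simp: galois_group_def bij_comp)
next
  have "field_hom (id :: 'l \<Rightarrow> 'l)" by unfold_locales auto
  then show "\<one>\<^bsub>galois_group \<iota>\<^esub> \<in> carrier (galois_group \<iota>)" by (auto simp: galois_group_def)
qed (auto simp: galois_group_def)

locale cyclic_ext =
  fixes \<iota> :: "'k::field \<Rightarrow> 'l::field" and n :: nat and \<sigma> :: "'l \<Rightarrow> 'l"
  assumes cyclic: "cyclic_galois_extension \<iota> n \<sigma>"
begin

sublocale skew_poly \<sigma>
  using cyclic by (simp add: skew_poly_def cyclic_galois_extension_def galois_group_def)

sublocale iota: field_hom \<iota>
  using cyclic by (simp add: cyclic_galois_extension_def galois_extension_def)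

sublocale sigma_poly: map_poly_inj_idom_hom \<sigma> ..
sublocale iota_poly: map_poly_inj_idom_hom \<iota> ..

lemma n_pos: "n > 0"
  using cyclic by (auto simp: cyclic_galois_extension_def galois_extension_def)

lemma sigma_iota [simp]: "\<sigma> (\<iota> c) = \<iota> c"
  using cyclic by (auto simp: cyclic_galois_extension_def galois_group_def)

lemma funpow_iota [simp]: "(\<sigma> ^^ i) (\<iota> c) = \<iota> c"
  by (induction i) auto

text \<open>Being fixed passes from the generator to the whole Galois group, whose fixed field is
  the image of \<open>\<iota>\<close>.\<close>

lemma fixed_imp_range_iota:
  assumes "\<sigma> a = a"
  shows "a \<in> range \<iota>"
proof -
  interpret G: group "galois_group \<iota>" by (rule galois_group_group)
  have sG: "\<sigma> \<in> carrier (galois_group \<iota>)" and gen: "generate (galois_group \<iota>) {\<sigma>} = carrier (galois_group \<iota>)"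
    using cyclic by (auto simp: cyclic_galois_extension_def)
  have "\<tau> a = a" if "\<tau> \<in> generate (galois_group \<iota>) {\<sigma>}" for \<tau>
    using that
  proof induction
    case one
    then show ?case by (simp add: galois_group_def)
  next
    case (incl h)
    then show ?case using assms by simp
  next
    case (inv h)
    then have "inv\<^bsub>galois_group \<iota>\<^esub> h \<circ> \<sigma> = id"
      using G.l_inv[OF sG] by (simp add: galois_group_def)
    then show ?case by (metis assms comp_apply id_apply)
  next
    case (eng h1 h2)
    then show ?case by (simp add: galois_group_def)
  qed
  then have "\<forall>\<tau>\<in>carrier (galois_group \<iota>). \<tau> a = a" using gen by simp
  then show ?thesis using cyclic by (auto simp: cyclic_galois_extension_def galois_extension_def)
qed

section \<open>Independence of the powers of \<open>\<sigma>\<close> and the order of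
  \<open>\<sigma>\<close>\<close>

text \<open>The kernel of a nonzero operator has dimension over the small field at most its degree.
  A right factor \<open>l\<close> killing \<open>b t\<close> is split off; the kernel of
  \<open>l\<close> consists of the multiples of \<open>b t\<close> by fixed elements, so
  \<open>l\<close> keeps the remaining \<open>b j\<close> independent.\<close>

lemma skew_eval_kernel_bound:
  assumes "p \<noteq> 0" "\<And>j. j < t \<Longrightarrow> skew_eval p (b j) = 0"
    and "\<And>c j. (\<Sum>j<t. \<iota> (c j) * b j) = 0 \<Longrightarrow> j < t \<Longrightarrow> c j = 0"
  shows "t \<le> degree p"
  using assms
proof (induction t arbitrary: p b)
  case 0
  then show ?case by simp
next
  case (Suc t)
  have bt: "b t \<noteq> 0"
  proof
    assume "b t = 0"
    then have "(\<Sum>j<Suc t. \<iota> (if j = t then 1 else 0) * b j) = 0" by simp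
    from Suc.prems(3)[OF this, of t] show False by simp
  qed
  define l where "l = [:- (\<sigma> (b t) / b t), 1:]"
  have l: "l \<noteq> 0" "degree l = 1" by (auto simp: l_def)
  have ev_l: "skew_eval l a = \<sigma> a - \<sigma> (b t) / b t * a" for a
    by (simp add: l_def skew_eval_linear)
  obtain q r where qr: "p = q \<star> l + r" "r \<in> skew_remainders l"
    using skew_right_division[OF l(1)] by blast
  then obtain r0 where r0: "r = [:r0:]"
    using l by (auto simp: skew_remainders_def elim: degree_eq_zeroE)
  have "skew_eval p (b t) = r0 * b t"
    using bt by (simp add: qr(1) r0 skew_eval_add skew_eval_mult skew_eval_const ev_l)
  then have "r0 = 0" using Suc.prems(2)[of t] bt by simp
  then have p: "p = q \<star> l" using qr(1) r0 by simp
  then have "q \<noteq> 0" using Suc.prems(1) by auto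
  have "t \<le> degree q"
  proof (rule Suc.IH[of q "\<lambda>j. skew_eval l (b j)"])
    fix j assume "j < t"
    then show "skew_eval q (skew_eval l (b j)) = 0"
      using Suc.prems(2)[of j] p by (simp add: skew_eval_mult)
  next
    fix c j assume sum0: "(\<Sum>j<t. \<iota> (c j) * skew_eval l (b j)) = 0" and j: "j < t"
    define a where "a = (\<Sum>j<t. \<iota> (c j) * b j)"
    have "skew_eval l a = (\<Sum>j<t. \<iota> (c j) * skew_eval l (b j))"
      by (simp add: ev_l a_def hom_sum hom_mult sum_distrib_left sum_subtractf right_diff_distrib mult.left_commute)
    then have "\<sigma> (a / b t) = a / b t"
      using sum0 bt by (simp add: ev_l hom_div field_simps)
    then obtain k where "a / b t = \<iota> k" using fixed_imp_range_iota by auto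
    then have "(\<Sum>j<Suc t. \<iota> (if j < t then c j else - k) * b j) = 0"
      using bt by (simp add: a_def iota.hom_uminus field_simps)
    from Suc.prems(3)[OF this, of j] show "c j = 0" using j by simp
  qed fact
  then show ?case using degree_skew_mult[OF \<open>q \<noteq> 0\<close> l(1)] p l by simp
qed

lemma ex_basis:
  "\<exists>b :: nat \<Rightarrow> 'l. (\<forall>c. (\<Sum>j<n. \<iota> (c j) * b j) = 0 \<longrightarrow> (\<forall>j<n. c j = 0)) \<and>
     (\<forall>a. \<exists>c. a = (\<Sum>j<n. \<iota> (c j) * b j))"
proof -
  interpret V: vector_space "\<lambda>c v. \<iota> c * v"
    by unfold_locales (auto simp: algebra_simps iota.hom_add iota.hom_mult)
  obtain B where B: "V.independent B" "V.span B = UNIV" "card B = n"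
    using V.basis_exists[of UNIV] cyclic
    unfolding cyclic_galois_extension_def extension_degree_def by (metis top.extremum_uniqueI)
  have fin: "finite B" using B n_pos card_gt_0_iff by metis
  obtain b where b: "bij_betw b {..<n} B"
    using ex_bij_betw_nat_finite[OF fin] B(3) by (auto simp: atLeast0LessThan)
  show ?thesis
  proof (intro exI[of _ b] conjI allI impI)
    fix c j assume c: "(\<Sum>j<n. \<iota> (c j) * b j) = 0" and j: "j < n"
    define u where "u v = c (the_inv_into {..<n} b v)" for v
    have u: "u (b j) = c j" if "j < n" for j
      using b that by (simp add: u_def the_inv_into_f_f bij_betw_def)
    have "(\<Sum>v\<in>B. \<iota> (u v) * v) = (\<Sum>j<n. \<iota> (u (b j)) * b j)"
      by (rule sum.reindex_bij_betw[OF b, symmetric])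
    also have "\<dots> = 0" using c by (simp add: u)
    finally have "u (b j) = 0"
      using V.independentD[OF B(1) fin subset_refl] b j by (auto simp: bij_betw_def)
    then show "c j = 0" using u j by simp
  next
    fix a
    have aB: "a \<in> V.span B" using B(2) by simp
    obtain u where "a = (\<Sum>v\<in>B. \<iota> (u v) * v)" using aB by (auto simp: V.span_finite[OF fin])
    also have "\<dots> = (\<Sum>j<n. \<iota> (u (b j)) * b j)" by (rule sum.reindex_bij_betw[OF b, symmetric])
    finally have "a = (\<Sum>j<n. \<iota> (u (b j)) * b j)" .
    then show "\<exists>c. a = (\<Sum>j<n. \<iota> (c j) * b j)" by (intro exI[of _ "\<lambda>j. u (b j)"])
  qed
qed

text \<open>Linear independence of the powers of \<open>\<sigma>\<close> below \<open>n\<close> over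
  the large field: otherwise a kernel of dimension \<open>n\<close> would exceed the degree.\<close>

lemma skew_eval_eq_0_imp_eq_0:
  assumes "\<And>a. skew_eval p a = 0" "degree p < n"
  shows "p = 0"
proof (rule ccontr)
  assume "p \<noteq> 0"
  obtain b :: "nat \<Rightarrow> 'l" where b: "\<forall>c. (\<Sum>j<n. \<iota> (c j) * b j) = 0 \<longrightarrow> (\<forall>j<n. c j = 0)"
    using ex_basis by auto
  have "n \<le> degree p" by (rule skew_eval_kernel_bound[OF \<open>p \<noteq> 0\<close>, of n b]) (use assms b in auto)
  then show False using assms(2) by simp
qed

text \<open>Otherwise \<open>x\<^sup>i - 1\<close> would act as zero although its degree is less
  than \<open>n\<close>.\<close>

lemma funpow_less_n_neq_id:
  assumes "0 < i" "i < n"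
  shows "\<exists>a. (\<sigma> ^^ i) a \<noteq> a"
proof (rule ccontr)
  assume "\<nexists>a. (\<sigma> ^^ i) a \<noteq> a"
  then have ev: "skew_eval (monom 1 i - 1) a = 0" for a
    using skew_eval_const[of 1] by (simp add: skew_eval_diff skew_eval_monom one_pCons)
  have "degree (monom 1 i - 1 :: 'l poly) \<le> i"
    by (intro degree_diff_le) (auto simp: degree_monom_le)
  then have "monom 1 i - 1 = (0 :: 'l poly)"
    using skew_eval_eq_0_imp_eq_0[OF ev] assms(2) by simp
  then have "coeff (monom 1 i) i = coeff (1 :: 'l poly) i" by simp
  then show False using assms(1) by simp
qed

text \<open>Let \<open>p\<close> have degree \<open>n\<close> and vanish on the whole field. Then \<open>\<sigma>\<^sup>n(a) p - p a\<close> also vanishes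
  there and has degree less than \<open>n\<close>, so it is \<open>0\<close>; the constant coefficients give \<open>\<sigma>\<^sup>n(a) = a\<close>.\<close>

lemma funpow_n [simp]: "(\<sigma> ^^ n) a = a"
proof -
  obtain b :: "nat \<Rightarrow> 'l" where b: "\<forall>a. \<exists>c. a = (\<Sum>j<n. \<iota> (c j) * b j)"
    using ex_basis by auto
  obtain p where p: "p \<noteq> 0" "degree p \<le> n" "\<And>j. j < n \<Longrightarrow> skew_eval p (b j) = 0"
    using ex_skew_eval_annihilator[of n b] by auto
  have p0: "skew_eval p a = 0" for a
  proof -
    obtain c where "a = (\<Sum>j<n. \<iota> (c j) * b j)" using b by blast
    then have "skew_eval p a = (\<Sum>i\<le>degree p. \<Sum>j<n. \<iota> (c j) * (coeff p i * (\<sigma> ^^ i) (b j)))"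
      by (simp add: skew_eval_def funpow_sum sum_distrib_left mult_ac)
    also have "\<dots> = (\<Sum>j<n. \<iota> (c j) * skew_eval p (b j))"
      by (subst sum.swap) (simp add: skew_eval_def sum_distrib_left)
    finally have "skew_eval p a = (\<Sum>j<n. \<iota> (c j) * skew_eval p (b j))" .
    then show ?thesis using p(3) by simp
  qed
  have "n \<le> degree p"
    using skew_eval_eq_0_imp_eq_0[OF p0] p(1) by (meson not_le)
  with p(2) have deg: "degree p = n" by simp
  have comm: "coeff p i * (\<sigma> ^^ n) a = coeff p i * (\<sigma> ^^ i) a" for i a
  proof (cases "i = n")
    case False
    define q where "q = [:(\<sigma> ^^ n) a:] \<star> p - p \<star> [:a:]"
    have coeff_q: "coeff q i = coeff p i * ((\<sigma> ^^ n) a - (\<sigma> ^^ i) a)" for i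
    proof -
      have "coeff (p \<star> [:a:]) i = (\<Sum>j\<le>i. if j = i then coeff p i * (\<sigma> ^^ i) a else 0)"
        unfolding coeff_skew_mult by (intro sum.cong) (auto simp: coeff_pCons split: nat.splits)
      then show ?thesis by (simp add: q_def const_skew_mult algebra_simps)
    qed
    have "degree q < n"
    proof -
      have "coeff q i = 0" if "i \<ge> n" for i
        using that deg by (cases "i = n") (auto simp: coeff_q coeff_eq_0)
      then have "q \<noteq> 0 \<Longrightarrow> degree q < n" by (meson leading_coeff_0_iff not_le)
      then show ?thesis using n_pos by (cases "q = 0") auto
    qed
    moreover have "skew_eval q c = 0" for c
      by (simp add: q_def skew_eval_diff skew_eval_mult p0)
    ultimately have "q = 0" using skew_eval_eq_0_imp_eq_0 by blast
    then show ?thesis using coeff_q[of i] by auto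
  qed simp
  \<comment> \<open>A nonzero coefficient at \<open>0 < i < n\<close> would give
    \<open>\<sigma>\<^sup>n = \<sigma>\<^sup>i\<close> and hence
    \<open>\<sigma>\<^sup>n\<^sup>-\<^sup>i = id\<close>. So if the constant coefficient were
    \<open>0\<close>, then \<open>p\<close> would be a monomial of degree \<open>n\<close>, which
    does not kill \<open>1\<close>.\<close>
  have "coeff p 0 \<noteq> 0"
  proof
    assume c0: "coeff p 0 = 0"
    have "coeff p i = 0" if i: "0 < i" "i < n" for i
    proof (rule ccontr)
      assume "coeff p i \<noteq> 0"
      moreover have "(\<sigma> ^^ n) a = (\<sigma> ^^ i) ((\<sigma> ^^ (n - i)) a)" for a
        using i funpow_add[of i "n - i" \<sigma>] by simp
      ultimately have *: "(\<sigma> ^^ i) ((\<sigma> ^^ (n - i)) a) = (\<sigma> ^^ i) a" for a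
        using comm[of i a] by simp
      have "(\<sigma> ^^ (n - i)) a = a" for a
        using *[of a] funpow_simps(8)[of i "(\<sigma> ^^ (n - i)) a - a"] by simp
      with funpow_less_n_neq_id[of "n - i"] i show False by auto
    qed
    then have "coeff p i = 0" if "i \<noteq> n" for i
      using that c0 deg by (cases "i = 0"; cases "i < n") (auto simp: coeff_eq_0)
    then have "skew_eval p 1 = coeff p n"
      unfolding skew_eval_def deg by (simp add: sum.remove[of "{..n}" n])
    with p0 deg p(1) show False by auto
  qed
  then show ?thesis using comm[of 0 a] by simp
qed

lemma funpow_mult_n [simp]: "(\<sigma> ^^ (n * i)) a = a"
  by (induction i) (simp_all add: funpow_add)

lemma ex_map_poly_iota:
  assumes "map_poly \<sigma> p = p"
  shows "\<exists>q. p = map_poly \<iota> q"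
proof -
  define g where "g = inv_into UNIV \<iota>"
  have g0: "g 0 = 0" by (metis g_def inv_into_f_f iota.inj_f iota.hom_zero UNIV_I)
  have "coeff p i \<in> range \<iota>" for i
    using assms by (metis coeff_map_poly fixed_imp_range_iota hom_zero)
  then have "\<iota> (g (coeff p i)) = coeff p i" for i by (simp add: g_def f_inv_into_f)
  then have "p = map_poly \<iota> (map_poly g p)" by (intro poly_eqI) (simp add: coeff_map_poly g0)
  then show ?thesis ..
qed

lemma finite_extension_field:
  assumes "finite (UNIV :: 'k set)"
  shows "finite (UNIV :: 'l set)"
proof -
  obtain b :: "nat \<Rightarrow> 'l" where b: "\<forall>a. \<exists>c. a = (\<Sum>j<n. \<iota> (c j) * b j)"
    using ex_basis by auto
  have "UNIV \<subseteq> (\<lambda>c. \<Sum>j<n. \<iota> (c j) * b j) ` ({..<n} \<rightarrow>\<^sub>E UNIV)"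
  proof
    fix a
    obtain c where "a = (\<Sum>j<n. \<iota> (c j) * b j)" using b by blast
    then have "a = (\<Sum>j<n. \<iota> (restrict c {..<n} j) * b j)" by simp
    then show "a \<in> (\<lambda>c. \<Sum>j<n. \<iota> (c j) * b j) ` ({..<n} \<rightarrow>\<^sub>E UNIV)"
      unfolding image_iff by (intro bexI[of _ "restrict c {..<n}"]) auto
  qed
  moreover have "finite ({..<n} \<rightarrow>\<^sub>E (UNIV :: 'k set))" using assms by (intro finite_PiE) auto
  ultimately show ?thesis by (meson finite_imageI finite_subset)
qed

section \<open>Polynomials in \<open>x\<^sup>n\<close> and their centrality\<close>

lemma subst_monom: "monom c i \<circ>\<^sub>p monom 1 n = (monom c (n * i) :: 'l poly)"
proof -
  have "monom c i \<circ>\<^sub>p monom 1 n = Polynomial.smult c (monom 1 n ^ i)"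
    by (induction i) (simp_all add: monom_0 monom_Suc pcompose_pCons pcompose_smult)
  then show ?thesis by (simp add: monom_power smult_monom)
qed

lemma degree_subst: "degree (p \<circ>\<^sub>p monom 1 n) = n * degree (p :: 'l poly)"
  by (simp add: degree_pcompose degree_monom_eq)

lemma subst_eq_0_iff: "p \<circ>\<^sub>p monom 1 n = 0 \<longleftrightarrow> p = (0 :: 'l poly)"
  using n_pos by (subst pcompose_eq_0_iff) (auto simp: degree_monom_eq)

text \<open>Since \<open>\<sigma>\<^sup>n = id\<close>, the ordinary and the skew product with a polynomial in \<open>x\<^sup>n\<close> on the left
  agree.\<close>

lemma subst_skew_mult: "(p \<circ>\<^sub>p monom 1 n) \<star> v = (p \<circ>\<^sub>p monom 1 n) * v"
proof (induction p rule: poly_monom_induct)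
  case (monom c i)
  show ?case
    by (induction v rule: poly_monom_induct)
      (simp_all add: subst_monom skew_mult_distrib skew_mult_monom mult_monom ring_distribs)
qed (simp add: skew_mult_distrib pcompose_add ring_distribs)

text \<open>As an ordinary composition, \<open>P(x\<^sup>n)\<close> inherits additivity,
  multiplicativity and the degree formula from \<open>pcompose\<close>.\<close>

lemma central_poly_eq_subst: "central_poly \<iota> n P = map_poly \<iota> P \<circ>\<^sub>p monom 1 n"
proof -
  have "map_poly \<iota> P = (\<Sum>i\<le>degree P. monom (\<iota> (coeff P i)) i)"
    using poly_as_sum_of_monoms[of "map_poly \<iota> P"] by simp
  then show ?thesis by (simp add: central_poly_def pcompose_sum subst_monom)
qed

abbreviation Z :: "'k poly \<Rightarrow> 'l poly" where "Z P \<equiv> central_poly \<iota> n P"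

lemma Z_skew_mult: "Z P \<star> v = Z P * v"
  by (simp add: central_poly_eq_subst subst_skew_mult)

text \<open>The coefficients are fixed by \<open>\<sigma>\<close>, and \<open>x\<^sup>n\<close>
  commutes with constants because \<open>\<sigma>\<^sup>n = id\<close>.\<close>

lemma skew_mult_Z: "v \<star> Z P = Z P \<star> v"
  unfolding Z_skew_mult
proof (induction P rule: poly_monom_induct)
  case (add P Q)
  then show ?case
    by (simp add: central_poly_eq_subst iota.map_poly_hom_add pcompose_add skew_mult_distrib ring_distribs)
next
  case (monom c i)
  show ?case
    by (induction v rule: poly_monom_induct)
      (simp_all add: central_poly_eq_subst subst_monom map_poly_monom skew_mult_distrib
        skew_mult_monom mult_monom ring_distribs mult.commute add.commute)
qed

lemma Z_mult: "Z (P * Q) = Z P \<star> Z Q"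
  by (simp add: Z_skew_mult) (simp add: central_poly_eq_subst iota_poly.hom_mult pcompose_mult)

lemma degree_Z: "degree (Z P) = n * degree P"
  unfolding central_poly_eq_subst degree_subst by simp

lemma Z_eq_0_iff [simp]: "Z P = 0 \<longleftrightarrow> P = 0"
  by (simp add: central_poly_eq_subst subst_eq_0_iff)

text \<open>Left multiples of a central element form a two-sided ideal. This bounds from above the
  ideal generated by \<open>Z P\<close>.\<close>

lemma ideal_Z: "ideal {q \<star> Z P | q. True} (skew_ring \<sigma>)"
proof (rule idealI)
  show "ring (skew_ring \<sigma>)" by (rule ring_skew_ring)
  interpret ring "skew_ring \<sigma>" by (rule ring_skew_ring)
  show "subgroup {q \<star> Z P | q. True} (add_monoid (skew_ring \<sigma>))"
  proof (rule add.subgroupI)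
    fix a assume "a \<in> {q \<star> Z P | q. True}"
    then obtain q where a: "a = q \<star> Z P" by auto
    have "\<ominus>\<^bsub>skew_ring \<sigma>\<^esub> a = - a"
      by (rule minus_equality) (auto simp: skew_ring_def)
    also have "\<dots> = (0 - q) \<star> Z P" unfolding skew_mult_diff a by simp
    finally show "\<ominus>\<^bsub>skew_ring \<sigma>\<^esub> a \<in> {q \<star> Z P | q. True}" by blast
  qed (auto simp: skew_ring_def simp flip: skew_mult_distrib)
next
  fix a x assume "a \<in> {q \<star> Z P | q. True}"
  then obtain q where a: "a = q \<star> Z P" by auto
  have "a \<star> x = (q \<star> x) \<star> Z P" by (simp add: a skew_mult_assoc skew_mult_Z)
  then show "a \<otimes>\<^bsub>skew_ring \<sigma>\<^esub> x \<in> {q \<star> Z P | q. True}" by (auto simp: skew_ring_def)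
  have "x \<star> a = (x \<star> q) \<star> Z P" by (simp add: a skew_mult_assoc)
  then show "x \<otimes>\<^bsub>skew_ring \<sigma>\<^esub> a \<in> {q \<star> Z P | q. True}" by (auto simp: skew_ring_def)
qed

end

section \<open>General facts on polynomials, matrices and groups\<close>

text \<open>Two distinct monic annihilators of least degree would differ by a nonzero annihilator of
  smaller degree. The assumption \<open>diff\<close> carries the linearity of
  \<open>scale\<close>.\<close>

lemma min_poly_eqI:
  assumes "lead_coeff p = 1" "\<forall>v\<in>V. poly_map_apply scale p T v = 0"
    and deg: "\<And>q. q \<noteq> 0 \<Longrightarrow> \<forall>v\<in>V. poly_map_apply scale q T v = 0 \<Longrightarrow> degree p \<le> degree q"
    and diff: "\<And>q. \<forall>v\<in>V. poly_map_apply scale q T v = 0 \<Longrightarrow> \<forall>v\<in>V. poly_map_apply scale (p - q) T v = 0"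
  shows "min_poly scale V T = p"
  unfolding min_poly_def
proof (rule the_equality)
  fix q assume q: "lead_coeff q = 1 \<and> (\<forall>v\<in>V. poly_map_apply scale q T v = 0) \<and>
     (\<forall>r. r \<noteq> 0 \<and> (\<forall>v\<in>V. poly_map_apply scale r T v = 0) \<longrightarrow> degree q \<le> degree r)"
  then have d: "degree q = degree p"
    using assms(1,2) deg[of q] by (metis le_antisym leading_coeff_0_iff zero_neq_one)
  show "q = p"
  proof (rule ccontr)
    assume "q \<noteq> p"
    then have "degree p \<le> degree (p - q)" using diff[of q] q by (intro deg) auto
    moreover have "coeff (p - q) (degree p) = 0" using q assms(1) d by simp
    moreover have "degree (p - q) \<le> degree p" using d by (intro degree_diff_le) auto
    ultimately have "lead_coeff (p - q) = 0" by simp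
    then show False using \<open>q \<noteq> p\<close> unfolding leading_coeff_0_iff by simp
  qed
qed (use assms in auto)

text \<open>Makes the results on left ideals and Bezout identities available for ordinary
  polynomials.\<close>

lemma skew_mult_id: "skew_mult id p q = p * (q :: 'a::field poly)"
proof -
  interpret skew_poly "id :: 'a \<Rightarrow> 'a" by unfold_locales auto
  show ?thesis by (rule poly_eqI) (simp add: coeff_skew_mult coeff_mult)
qed

lemma irreducible_bezout:
  fixes F p :: "'a::field poly"
  assumes "degree F > 0" "\<And>G H. F = G * H \<Longrightarrow> degree G = 0 \<or> degree H = 0" "\<not> F dvd p"
  shows "\<exists>a b. a * p + b * F = 1"
proof -
  interpret skew_poly "id :: 'a \<Rightarrow> 'a" by unfold_locales auto
  have "skew_irreducible id F"
    unfolding skew_irreducible_iff skew_mult_id using assms(1,2) by blast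
  moreover have "\<nexists>q. p = q * F" using assms(3) by (auto simp: dvd_def mult.commute)
  ultimately show ?thesis
    using skew_irreducible_bezout[of F p] unfolding skew_mult_id by blast
qed

text \<open>Induction on the exponent: either a factor \<open>F\<close> is removed from
  \<open>p\<close>, or a Bezout identity for \<open>p\<close> and \<open>F\<close> shows that
  \<open>p\<close> already divides the next lower power.\<close>

lemma monic_dvd_irreducible_power:
  fixes F p :: "'a::field poly"
  assumes "degree F > 0" "\<And>G H. F = G * H \<Longrightarrow> degree G = 0 \<or> degree H = 0" "lead_coeff F = 1"
    and "p dvd F ^ N" "lead_coeff p = 1"
  shows "\<exists>k. p = F ^ k"
  using assms(4,5)
proof (induction N arbitrary: p)
  case 0
  then have "p dvd 1" by simp
  then have "degree p = 0" by (simp add: poly_dvd_1)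
  with 0 show ?case by (intro exI[of _ 0]) (auto elim!: degree_eq_zeroE simp: one_pCons)
next
  case (Suc N)
  show ?case
  proof (cases "F dvd p")
    case True
    then obtain q where q: "p = F * q" by (elim dvdE)
    then have "q dvd F ^ N" "lead_coeff q = 1"
      using Suc.prems assms(1,3) by (auto simp: lead_coeff_mult)
    then obtain k where "q = F ^ k" using Suc.IH by blast
    then show ?thesis using q by (intro exI[of _ "Suc k"]) simp
  next
    case False
    then obtain a b where "a * p + b * F = 1" using irreducible_bezout assms(1,2) by blast
    then have "F ^ N = F ^ N * (a * p + b * F)" by simp
    also have "\<dots> = p * (a * F ^ N) + b * F ^ Suc N" by (simp add: algebra_simps)
    finally have "p dvd F ^ N" using Suc.prems(1) by (metis dvd_add dvd_mult dvd_triv_left)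
    then show ?thesis using Suc by blast
  qed
qed

text \<open>\<open>foldr\<close> unfolds at the left end, whereas the product \<open>A_mat\<close>
  grows at the right end.\<close>

lemma foldr_mult_mat:
  fixes Y :: "'a::semiring_1 mat"
  assumes "\<forall>X\<in>set Xs. X \<in> carrier_mat h h" "Y \<in> carrier_mat h h"
  shows "foldr (*) Xs Y = foldr (*) Xs (1\<^sub>m h) * Y \<and> foldr (*) Xs Y \<in> carrier_mat h h"
  using assms
proof (induction Xs)
  case (Cons X Xs)
  moreover have "foldr (*) Xs (1\<^sub>m h) \<in> carrier_mat h h"
    using Cons.prems by (induction Xs) auto
  ultimately show ?case
    using mult_carrier_mat[of _ h h Y h] mult_carrier_mat[of X h h _ h]
    by (simp add: assoc_mult_mat[of X h h _ h _ h])
qed simp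

text \<open>Evaluation respects congruences. It is applied with a norm congruent to \<open>y\<close>
  in place of \<open>w\<close>.\<close>

lemma dvd_pcompose_diff: "w - [:0, 1:] dvd p \<circ>\<^sub>p w - (p :: 'a::comm_ring_1 poly)"
proof (induction p)
  case (pCons a p)
  have "pCons a p \<circ>\<^sub>p w - pCons a p = w * (p \<circ>\<^sub>p w - p) + (w - [:0, 1:]) * p"
    by (simp add: pcompose_pCons algebra_simps)
  then show ?case using pCons by simp
qed simp

text \<open>Every nonempty fibre is a coset of the kernel.\<close>

lemma (in group_hom) card_kernel_image:
  assumes "finite (carrier G)"
  shows "card (carrier G) = card (kernel G H h) * card (h ` carrier G)"
proof -
  have fibre: "card {x \<in> carrier G. h x = y} = card (kernel G H h)" if y: "y \<in> h ` carrier G" for y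
  proof -
    obtain g where g: "g \<in> carrier G" "y = h g" using y by auto
    have "bij_betw (\<lambda>k. k \<otimes> g) (kernel G H h) {x \<in> carrier G. h x = y}"
    proof (rule bij_betwI[where g = "\<lambda>x. x \<otimes> inv g"])
      show "(\<lambda>k. k \<otimes> g) \<in> kernel G H h \<rightarrow> {x \<in> carrier G. h x = y}"
        using g by (auto simp: kernel_def)
      show "(\<lambda>x. x \<otimes> inv g) \<in> {x \<in> carrier G. h x = y} \<rightarrow> kernel G H h"
        using g by (auto simp: kernel_def)
    qed (use g in \<open>auto simp: kernel_def G.m_assoc\<close>)
    then show ?thesis using bij_betw_same_card by metis
  qed
  have "card (carrier G) = (\<Sum>y\<in>h ` carrier G. card {x \<in> carrier G. h x = y})"
    using sum.image_gen[OF assms, of "\<lambda>_. 1 :: nat" h] by simp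
  then show ?thesis using fibre by simp
qed

text \<open>The order of the kernel of \<open>u \<mapsto> u / \<tau>(u)\<close> is the number of fixed points of \<open>\<tau>\<close>, so if
  every element of norm one is of this form then the norm has as many values as \<open>\<tau>\<close> has fixed
  points.\<close>

lemma (in comm_group) norm_surjective:
  assumes fin: "finite (carrier G)" and \<tau>: "\<tau> \<in> hom G G" and N: "N \<in> hom G G"
    and inv: "\<And>u. u \<in> carrier G \<Longrightarrow> \<tau> (N u) = N u"
    and h90: "\<And>c. c \<in> carrier G \<Longrightarrow> N c = \<one> \<Longrightarrow> \<exists>b\<in>carrier G. b = c \<otimes> \<tau> b"
    and t: "t \<in> carrier G" "\<tau> t = t"
  shows "\<exists>c\<in>carrier G. N c = t"
proof -
  have \<tau>_closed: "\<tau> u \<in> carrier G" if "u \<in> carrier G" for u using \<tau> that by (auto simp: hom_def)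
  define \<beta> where "\<beta> = (\<lambda>u. u \<otimes> inv (\<tau> u))"
  interpret N: group_hom G G N by unfold_locales (rule N)
  interpret b: group_hom G G \<beta>
  proof unfold_locales
    show "\<beta> \<in> hom G G"
    proof (rule homI)
      fix u v assume uv: "u \<in> carrier G" "v \<in> carrier G"
      then have "\<tau> (u \<otimes> v) = \<tau> u \<otimes> \<tau> v" using \<tau> by (simp add: hom_mult)
      then show "\<beta> (u \<otimes> v) = \<beta> u \<otimes> \<beta> v"
        using uv \<tau>_closed by (simp add: \<beta>_def inv_mult m_ac)
    qed (simp add: \<beta>_def \<tau>_closed)
  qed
  have ker: "kernel G G \<beta> = {u \<in> carrier G. \<tau> u = u}"
  proof -
    have "u \<otimes> inv (\<tau> u) = \<one> \<longleftrightarrow> \<tau> u = u" if "u \<in> carrier G" for u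
      using that \<tau>_closed[OF that] by (metis inv_closed inv_inv inv_equality r_inv)
    then show ?thesis by (auto simp: kernel_def \<beta>_def)
  qed
  have "kernel G G N \<subseteq> \<beta> ` carrier G"
  proof
    fix c assume "c \<in> kernel G G N"
    then have c: "c \<in> carrier G" "N c = \<one>" by (auto simp: kernel_def)
    then obtain b where b: "b \<in> carrier G" "b = c \<otimes> \<tau> b" using h90 by blast
    have "b \<otimes> inv (\<tau> b) = c"
      using b c(1) \<tau>_closed[OF b(1)] by (metis inv_solve_right)
    then show "c \<in> \<beta> ` carrier G" using b(1) by (auto simp: \<beta>_def)
  qed
  then have le: "card (kernel G G N) \<le> card (\<beta> ` carrier G)"
    by (intro card_mono) (auto simp: fin)
  have "N ` carrier G \<subseteq> kernel G G \<beta>"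
    using inv by (auto simp: ker)
  \<comment> \<open>The order of the group is the product of kernel and image orders for both
    \<open>N\<close> and \<open>\<beta>\<close>. As the kernel of \<open>N\<close> is no larger than
    the image of \<open>\<beta>\<close>, the image of \<open>N\<close> is no smaller than the kernel
    of \<open>\<beta>\<close>.\<close>
  moreover have "card (kernel G G \<beta>) \<le> card (N ` carrier G)"
  proof (rule ccontr)
    assume "\<not> ?thesis"
    then have lt: "card (N ` carrier G) < card (kernel G G \<beta>)" by simp
    have "\<one> \<in> kernel G G N" by (simp add: kernel_def)
    then have "card (kernel G G N) > 0"
      using fin by (auto simp: card_gt_0_iff kernel_def)
    then have "card (kernel G G N) * card (N ` carrier G) < card (kernel G G \<beta>) * card (\<beta> ` carrier G)"
      using le lt by (metis mult.commute mult_less_le_imp_less zero_le less_le_trans)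
    then show False using N.card_kernel_image[OF fin] b.card_kernel_image[OF fin] by simp
  qed
  moreover have "finite (kernel G G \<beta>)" using fin by (auto simp: kernel_def)
  ultimately have "N ` carrier G = kernel G G \<beta>" by (rule card_seteq[rotated])
  then show ?thesis using t ker by (metis (mono_tags, lifting) imageE mem_Collect_eq)
qed

text \<open>There are \<open>e + 1\<close> vectors in a space of dimension \<open>e\<close>.
  Dependence speaks of sets of vectors, so a repetition \<open>w i = w j\<close> is treated
  separately.\<close>

lemma ex_linear_relation:
  fixes w :: "nat \<Rightarrow> 'a::field poly"
  assumes "\<And>i. degree (w i) < e"
  shows "\<exists>r. r \<noteq> 0 \<and> degree r \<le> e \<and> (\<Sum>i\<le>e. Polynomial.smult (coeff r i) (w i)) = 0"
proof (cases "inj_on w {..e}")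
  case False
  then obtain i j where ij: "i \<le> e" "j \<le> e" "i \<noteq> j" "w i = w j" by (auto simp: inj_on_def)
  define r :: "'a poly" where "r = monom 1 i - monom 1 j"
  have "coeff r i = 1" using ij by (simp add: r_def)
  then have "r \<noteq> 0" by auto
  moreover have "degree r \<le> e"
    unfolding r_def using ij by (intro degree_diff_le) (auto simp: degree_monom_eq)
  moreover have "(\<Sum>k\<le>e. Polynomial.smult (coeff r k) (w k))
      = (\<Sum>k\<le>e. (if i = k then w i else 0) - (if j = k then w j else 0))"
    by (intro sum.cong) (auto simp: r_def)
  then have "(\<Sum>k\<le>e. Polynomial.smult (coeff r k) (w k)) = 0"
    using ij by (simp add: sum_subtractf)
  ultimately show ?thesis by blast
next
  case True
  interpret V: vector_space "Polynomial.smult :: 'a \<Rightarrow> 'a poly \<Rightarrow> 'a poly"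
    by unfold_locales (auto simp: smult_add_right smult_add_left)
  define T :: "'a poly set" where "T = monom 1 ` {..<e}"
  have "p \<in> V.span T" if "degree p < e" for p
  proof -
    have "p = (\<Sum>i\<le>degree p. Polynomial.smult (coeff p i) (monom 1 i))"
      using poly_as_sum_of_monoms[of p] by (simp add: smult_monom)
    also have "\<dots> \<in> V.span T"
      using that by (intro V.span_sum V.span_scale V.span_base) (auto simp: T_def)
    finally show ?thesis .
  qed
  then have "w ` {..e} \<subseteq> V.span T" using assms by auto
  moreover have "card T < card (w ` {..e})"
    using card_image_le[of "{..<e}" "monom 1"] True by (simp add: card_image[OF True] T_def less_Suc_eq_le)
  ultimately have "V.dependent (w ` {..e})"
    using V.independent_span_bound[of T "w ` {..e}"] by (auto simp: T_def)
  then obtain u where u: "\<exists>v\<in>w ` {..e}. u v \<noteq> 0" "(\<Sum>v\<in>w ` {..e}. Polynomial.smult (u v) v) = 0"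
    by (auto simp: V.dependent_finite)
  define r where "r = (\<Sum>i\<le>e. monom (u (w i)) i)"
  have coeff_r: "coeff r i = (if i \<le> e then u (w i) else 0)" for i
    by (simp add: r_def coeff_sum)
  obtain i where "i \<le> e" "u (w i) \<noteq> 0" using u(1) by auto
  then have "coeff r i \<noteq> 0" by (simp add: coeff_r)
  then have "r \<noteq> 0" by auto
  moreover have "degree r \<le> e" by (rule degree_le) (simp add: coeff_r)
  moreover have "(\<Sum>i\<le>e. Polynomial.smult (coeff r i) (w i)) = 0"
    using u(2) by (simp add: coeff_r sum.reindex[OF True])
  ultimately show ?thesis by blast
qed

lemma finite_degree_less:
  assumes "finite (UNIV :: 'a::zero set)"
  shows "finite {p :: 'a poly. degree p < e}"
proof -
  have "{p :: 'a poly. degree p < e} \<subseteq> Poly ` {xs. set xs \<subseteq> UNIV \<and> length xs \<le> e}"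
  proof
    fix p :: "'a poly" assume "p \<in> {p. degree p < e}"
    then have "length (coeffs p) \<le> e" by (cases "p = 0") (auto simp: length_coeffs)
    then show "p \<in> Poly ` {xs. set xs \<subseteq> UNIV \<and> length xs \<le> e}"
      by (intro image_eqI[of _ _ "coeffs p"]) auto
  qed
  then show ?thesis using finite_lists_length_le[OF assms, of e] finite_subset by fastforce
qed

section \<open>Irreducible skew polynomials and their bounds\<close>

locale irreducible_with_bound = cyclic_ext \<iota> n \<sigma>
  for \<iota> :: "'k::field \<Rightarrow> 'l::field" and n \<sigma> +
  fixes f :: "'l poly" and F :: "'k poly"
  assumes irr: "skew_irreducible \<sigma> f" and monic: "lead_coeff f = 1" and coeff_f_0: "coeff f 0 \<noteq> 0"
    and bound: "is_bound \<iota> n \<sigma> f F"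
begin

section \<open>The left ideal \<open>R f\<close> and the annihilator of its quotient\<close>

definition Rf :: "'l poly set" where "Rf = {q \<star> f | q. True}"

lemma f_neq_0: "f \<noteq> 0" and degree_f_pos: "degree f > 0"
  using irr by (auto simp: skew_irreducible_iff)

lemma Rf_add: "u \<in> Rf \<Longrightarrow> v \<in> Rf \<Longrightarrow> u + v \<in> Rf"
  by (auto simp: Rf_def simp flip: skew_mult_distrib)

lemma Rf_diff: "u \<in> Rf \<Longrightarrow> v \<in> Rf \<Longrightarrow> u - v \<in> Rf"
  by (auto simp: Rf_def simp flip: skew_mult_diff)

lemma Rf_mult: "v \<in> Rf \<Longrightarrow> u \<star> v \<in> Rf"
  by (auto simp: Rf_def simp flip: skew_mult_assoc)

lemma f_in_Rf: "f \<in> Rf"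
  unfolding Rf_def using skew_mult_1(1)[of f] by (auto intro: exI[of _ 1])

lemma one_notin_Rf: "1 \<notin> Rf"
proof
  assume "1 \<in> Rf"
  then obtain q where "1 = q \<star> f" by (auto simp: Rf_def)
  then show False using degree_skew_mult[of q f] degree_f_pos f_neq_0
    by (metis add_is_0 degree_1 neq0_conv skew_mult_0(1) zero_neq_one)
qed

lemma PIdl_eq: "PIdl\<^bsub>skew_ring \<sigma>\<^esub> f = Rf"
  by (simp add: cgenideal_def Rf_def skew_ring_def)

lemma F_monic: "lead_coeff F = 1" and F_neq_0: "F \<noteq> 0"
  using bound by (auto simp: is_bound_def)

lemma Z_F_in_Rf: "Z F \<in> Rf"
proof -
  have "Z F \<in> Idl\<^bsub>skew_ring \<sigma>\<^esub> {Z F}" by (auto simp: genideal_def)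
  then show ?thesis using bound unfolding is_bound_def PIdl_eq by auto
qed

lemma Z_Rf_mult: "Z P \<in> Rf \<Longrightarrow> Z P \<star> v \<in> Rf"
  using Rf_mult[of "Z P" v] by (simp add: skew_mult_Z)

text \<open>The annihilator of \<open>R / R f\<close> is a two-sided ideal, contained in
  \<open>R f\<close> since it kills the class of \<open>1\<close>; the bound generates the largest
  such ideal.\<close>

lemma annihilator_in_ideal:
  assumes "\<And>v. r \<star> v \<in> Rf"
  shows "\<exists>q. r = q \<star> Z F"
proof -
  interpret ring "skew_ring \<sigma>" by (rule ring_skew_ring)
  define I where "I = {r. \<forall>v. r \<star> v \<in> Rf}"
  have "ideal I (skew_ring \<sigma>)"
  proof (rule idealI)
    show "ring (skew_ring \<sigma>)" by (rule ring_skew_ring)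
    show "subgroup I (add_monoid (skew_ring \<sigma>))"
    proof (rule add.subgroupI)
      fix a assume a: "a \<in> I"
      have "\<ominus>\<^bsub>skew_ring \<sigma>\<^esub> a = - a"
        by (rule minus_equality) (auto simp: skew_ring_def)
      moreover have "- a \<star> v \<in> Rf" for v
        using Rf_diff[of "0 \<star> f" "a \<star> v"] a skew_mult_diff(1)[of 0 a v] by (auto simp: I_def Rf_def)
      ultimately show "\<ominus>\<^bsub>skew_ring \<sigma>\<^esub> a \<in> I" by (simp add: I_def)
    next
      have "0 \<star> f \<in> Rf" by (auto simp: Rf_def)
      then have "0 \<in> I" by (auto simp: I_def)
      then show "I \<noteq> {}" by auto
    qed (auto simp: skew_ring_def I_def skew_mult_distrib Rf_add)
  next
    fix a x assume "a \<in> I"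
    then show "a \<otimes>\<^bsub>skew_ring \<sigma>\<^esub> x \<in> I" "x \<otimes>\<^bsub>skew_ring \<sigma>\<^esub> a \<in> I"
      by (auto simp: skew_ring_def I_def skew_mult_assoc intro: Rf_mult)
  qed
  moreover have "I \<subseteq> Rf"
  proof
    fix a assume "a \<in> I"
    then have "a \<star> 1 \<in> Rf" unfolding I_def by blast
    then show "a \<in> Rf" by simp
  qed
  ultimately have "I \<subseteq> Idl\<^bsub>skew_ring \<sigma>\<^esub> {Z F}"
    using bound unfolding is_bound_def PIdl_eq by auto
  also have "\<dots> \<subseteq> {q \<star> Z F | q. True}"
  proof (rule genideal_minimal[OF ideal_Z])
    have "\<exists>q. Z F = q \<star> Z F" by (intro exI[of _ 1]) simp
    then show "{Z F} \<subseteq> {q \<star> Z F | q. True}" by simp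
  qed
  finally show ?thesis using assms by (auto simp: I_def)
qed

lemma annihilator_degree:
  assumes "\<And>v. r \<star> v \<in> Rf" "r \<noteq> 0"
  shows "n * degree F \<le> degree r"
proof -
  obtain q where "r = q \<star> Z F" using annihilator_in_ideal assms(1) by blast
  then show ?thesis using assms(2) by (auto simp: degree_skew_mult degree_Z)
qed

lemma Z_in_Rf_degree: "Z P \<in> Rf \<Longrightarrow> P \<noteq> 0 \<Longrightarrow> degree F \<le> degree P"
  using annihilator_degree[of "Z P"] Z_Rf_mult n_pos by (auto simp: degree_Z)

lemma degree_F_pos: "degree F > 0"
proof (rule ccontr)
  assume "\<not> degree F > 0"
  then have "Z F = 1" using F_monic
    by (auto elim!: degree_eq_zeroE simp: central_poly_def one_pCons monom_0)
  then show False using Z_F_in_Rf one_notin_Rf by simp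
qed

text \<open>\<open>R f\<close> behaves like a prime ideal for central elements: if
  \<open>Z H\<close> is outside, multiplying a Bezout identity for \<open>Z H\<close> and
  \<open>f\<close> by \<open>Z G\<close> puts \<open>Z G\<close> inside. The factor that lies inside
  has at least the degree of \<open>F\<close>.\<close>

lemma F_irreducible:
  assumes "F = G * H"
  shows "degree G = 0 \<or> degree H = 0"
proof (cases "Z H \<in> Rf")
  case True
  moreover have "G \<noteq> 0" "H \<noteq> 0" using assms F_neq_0 by auto
  ultimately show ?thesis using Z_in_Rf_degree[of H] assms by (auto simp: degree_mult_eq)
next
  case False
  then obtain a b where ab: "a \<star> Z H + b \<star> f = 1"
    using skew_irreducible_bezout[OF irr, of "Z H"] by (auto simp: Rf_def)
  have "Z G \<star> (a \<star> Z H) = a \<star> Z F"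
    by (metis Z_mult assms skew_mult_Z skew_mult_assoc)
  then have GF: "Z G \<star> (a \<star> Z H + b \<star> f) = a \<star> Z F + Z G \<star> b \<star> f"
    by (simp add: skew_mult_distrib skew_mult_assoc)
  have "Z G = Z G \<star> (a \<star> Z H + b \<star> f)" by (simp add: ab)
  also have "\<dots> = a \<star> Z F + Z G \<star> b \<star> f" by (rule GF)
  also have "\<dots> \<in> Rf"
    using Rf_mult[OF f_in_Rf] by (intro Rf_add Rf_mult[OF Z_F_in_Rf]) 
  finally have "Z G \<in> Rf" .
  moreover have "G \<noteq> 0" "H \<noteq> 0" using assms F_neq_0 by auto
  ultimately show ?thesis using Z_in_Rf_degree[of G] assms by (auto simp: degree_mult_eq)
qed

text \<open>\<open>x\<close> acts injectively on \<open>R / R f\<close>: in \<open>x v = q f\<close>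
  the nonzero constant coefficient of \<open>f\<close> forces \<open>q\<close> to have constant
  coefficient \<open>0\<close>, so \<open>x\<close> can be cancelled.\<close>

lemma monom_cancel_in_Rf:
  assumes "monom 1 i \<star> u \<in> Rf"
  shows "u \<in> Rf"
  using assms
proof (induction i)
  case 0
  then show ?case by simp
next
  case (Suc i)
  then obtain q where q: "monom 1 (Suc i) \<star> u = q \<star> f" by (auto simp: Rf_def)
  have x: "monom 1 (Suc i) = monom 1 1 \<star> monom 1 i" by (simp add: skew_mult_monom)
  have "coeff q 0 * coeff f 0 = 0"
    using arg_cong[OF q, of "\<lambda>p. coeff p 0"] by (simp add: coeff_skew_mult_0)
  then have q0: "coeff q 0 = 0" using coeff_f_0 by simp
  obtain q1 where q1: "q = pCons 0 q1" using q0 by (cases q) auto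
  \<comment> \<open>Writing \<open>q\<close> as \<open>x q'\<close> with \<open>x\<close> on the
    left requires the inverse of \<open>\<sigma>\<close> on coefficients.\<close>
  have "\<sigma> ((\<sigma> ^^ (n - 1)) a) = a" for a
    using n_pos funpow_n[of a] by (cases n) simp_all
  then have "map_poly \<sigma> (map_poly (\<sigma> ^^ (n - 1)) q1) = q1"
    by (simp add: map_poly_map_poly comp_def)
  then obtain q' where q': "q = monom 1 1 \<star> q'"
    unfolding q1 monom_1_skew_mult by metis
  then have "monom 1 1 \<star> (monom 1 i \<star> u) = monom 1 1 \<star> (q' \<star> f)"
    using q by (simp only: x skew_mult_assoc)
  then have "monom 1 i \<star> u = q' \<star> f" by (rule skew_mult_cancel_left) simp
  then have "monom 1 i \<star> u \<in> Rf" by (auto simp: Rf_def)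
  then show ?case by (rule Suc.IH)
qed

text \<open>If \<open>y\<close> divided \<open>F\<close>, cancelling \<open>x\<^sup>n\<close> would
  leave a central multiple of \<open>f\<close> of smaller degree. Consequently \<open>y\<close> is a
  unit modulo \<open>F\<close>.\<close>

lemma coeff_F_0: "coeff F 0 \<noteq> 0"
proof
  assume "coeff F 0 = 0"
  then obtain G where G: "F = [:0, 1:] * G"
    by (cases F) auto
  then have "G \<noteq> 0" using F_neq_0 by auto
  have "Z [:0, 1:] = monom 1 n"
    by (simp add: central_poly_def)
  then have "monom 1 n \<star> Z G \<in> Rf" using Z_F_in_Rf by (simp only: G Z_mult)
  then have "Z G \<in> Rf" by (rule monom_cancel_in_Rf)
  then have "degree F \<le> degree G" using Z_in_Rf_degree \<open>G \<noteq> 0\<close> by blast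
  moreover have "degree F = Suc (degree G)" using G \<open>G \<noteq> 0\<close> by simp
  ultimately show False by simp
qed

section \<open>Divisors of the bound\<close>

text \<open>Centrality gives \<open>Z F = g \<star> q\<close> as well. If \<open>g\<close> acted
  injectively on \<open>R / R f\<close>, then \<open>q\<close> would annihilate this module although
  its degree is less than that of \<open>Z F\<close>.\<close>

lemma divisor_torsion:
  assumes "Z F = q \<star> g" "degree g > 0"
  shows "\<exists>u. u \<notin> Rf \<and> g \<star> u \<in> Rf"
proof (rule ccontr)
  assume "\<nexists>u. u \<notin> Rf \<and> g \<star> u \<in> Rf"
  then have *: "u \<in> Rf" if "g \<star> u \<in> Rf" for u using that by blast
  have [simp]: "q \<noteq> 0" "g \<noteq> 0" using assms F_neq_0 by auto
  have "(g \<star> q) \<star> g = Z F \<star> g"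
    by (simp only: skew_mult_assoc skew_mult_Z flip: assms(1))
  then have gq: "g \<star> q = Z F" by (rule skew_mult_cancel) simp
  have "g \<star> (q \<star> v) \<in> Rf" for v
    using Z_Rf_mult[OF Z_F_in_Rf, of v] by (simp only: gq flip: skew_mult_assoc)
  then have "q \<star> v \<in> Rf" for v by (rule *)
  then have "n * degree F \<le> degree q" by (intro annihilator_degree) auto
  moreover have "n * degree F = degree q + degree g"
    using assms(1) degree_skew_mult[of q g] by (simp flip: degree_Z)
  ultimately show False using assms(2) by simp
qed

text \<open>For the torsion element \<open>u\<close>, the map \<open>r \<mapsto> r u\<close> from
  \<open>R / R g\<close> to the simple module \<open>R / R f\<close> is nonzero, hence onto. It
  covers reducible divisors too, as the finite case requires.\<close>

lemma degree_le_divisor: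
  assumes "Z F = q \<star> g" "degree g > 0"
  shows "degree f \<le> degree g"
proof -
  obtain u w where u: "u \<notin> Rf" "g \<star> u = w \<star> f"
    using divisor_torsion[OF assms] by (auto simp: Rf_def)
  obtain a b where ab: "a \<star> u + b \<star> f = 1"
    using skew_irreducible_bezout[OF irr, of u] u(1) by (auto simp: Rf_def)
  show ?thesis using degree_le_of_surjection[OF u(2) _ ab] assms(2) by fastforce
qed

text \<open>For the reverse inequality, the elements sending \<open>u\<close> into
  \<open>R f\<close> form a proper left ideal containing \<open>g\<close>, hence are left multiples
  of \<open>g\<close>; one of them is nonzero of degree at most \<open>degree f\<close>.\<close>

lemma degree_irreducible_divisor:
  assumes "Z F = q \<star> g" "skew_irreducible \<sigma> g"
  shows "degree g = degree f"
proof -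
  have g: "degree g > 0" using assms(2) by (simp add: skew_irreducible_iff)
  obtain u w where u: "u \<notin> Rf" "g \<star> u = w \<star> f"
    using divisor_torsion[OF assms(1) g] by (auto simp: Rf_def)
  obtain r w' where r: "r \<noteq> 0" "degree r \<le> degree f" "r \<star> u = w' \<star> f"
    using ex_left_multiple[OF f_neq_0] by blast
  have "\<exists>s. r = s \<star> g"
  proof (rule ccontr)
    assume "\<nexists>s. r = s \<star> g"
    then obtain a b where ab: "a \<star> r + b \<star> g = 1"
      using skew_irreducible_bezout[OF assms(2)] by blast
    have "u = (a \<star> r + b \<star> g) \<star> u" by (simp add: ab)
    also have "\<dots> = (a \<star> w' + b \<star> w) \<star> f"
      using r(3) u(2) by (simp add: skew_mult_distrib skew_mult_assoc)
    finally show False using u(1) by (auto simp: Rf_def)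
  qed
  then have "degree g \<le> degree r" using r(1) by (auto simp: degree_skew_mult)
  then show ?thesis using degree_le_divisor[OF assms(1) g] r(2) by simp
qed

lemma num_factors_degree:
  assumes "skew_num_irreducible_factors \<sigma> (Z F) m"
  shows "m * degree f = n * degree F"
proof -
  obtain gs where gs: "length gs = m" "\<And>g. g \<in> set gs \<Longrightarrow> skew_irreducible \<sigma> g"
    and prod: "Z F = foldr (\<star>) gs 1"
    using assms by (auto simp: skew_num_irreducible_factors_def)
  have foldr_acc: "foldr (\<star>) as v = foldr (\<star>) as 1 \<star> v" for as v
    by (induction as) (simp_all add: skew_mult_assoc)
  have "degree g = degree f" if g: "g \<in> set gs" for g
  proof -
    obtain as bs where "gs = as @ g # bs" using split_list[OF g] by blast
    define A B where "A = foldr (\<star>) as 1" and "B = foldr (\<star>) bs 1"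
    have AB: "Z F = A \<star> (g \<star> B)"
      using prod foldr_acc[of as "g \<star> B"] \<open>gs = _\<close> by (simp add: A_def B_def)
    then have "B \<noteq> 0" using F_neq_0 by auto
    \<comment> \<open>Moving \<open>B\<close> past the central element and cancelling it turns the
      inner factor \<open>g\<close> into a right divisor of \<open>Z F\<close>.\<close>
    have "B \<star> Z F = ((B \<star> A) \<star> g) \<star> B"
      by (simp only: AB skew_mult_assoc)
    then have "Z F \<star> B = ((B \<star> A) \<star> g) \<star> B"
      by (simp only: skew_mult_Z)
    then have "Z F = (B \<star> A) \<star> g" using \<open>B \<noteq> 0\<close> by (rule skew_mult_cancel)
    then show ?thesis using degree_irreducible_divisor gs(2)[OF g] by blast
  qed
  moreover have "degree (foldr (\<star>) as 1) = length as * degree f \<and> foldr (\<star>) as 1 \<noteq> 0"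
    if "\<forall>g\<in>set as. degree g = degree f" for as
    using that
  proof (induction as)
    case (Cons a as)
    then have "a \<noteq> 0" using degree_f_pos by auto
    then show ?case using Cons by (simp add: degree_skew_mult)
  qed simp
  ultimately have "degree (Z F) = m * degree f" using prod gs(1) by auto
  then show ?thesis by (simp add: degree_Z)
qed

section \<open>The minimal polynomials\<close>

lemma skew_mod_in_remainders: "skew_mod \<sigma> g f \<in> skew_remainders f"
  and skew_mod_diff_in_Rf: "g - skew_mod \<sigma> g f \<in> Rf"
proof -
  obtain q r where qr: "g = q \<star> f + r" "r \<in> skew_remainders f"
    using skew_right_division[OF f_neq_0] by blast
  then have r: "skew_mod \<sigma> g f = r" by (intro skew_mod_eqI)
  show "skew_mod \<sigma> g f \<in> skew_remainders f" using qr r by simp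
  show "g - skew_mod \<sigma> g f \<in> Rf" using qr r by (auto simp: Rf_def)
qed

lemma skew_mod_eqI': "r \<in> skew_remainders f \<Longrightarrow> g - r \<in> Rf \<Longrightarrow> skew_mod \<sigma> g f = r"
  using skew_mod_eqI[of r f g] by (force simp: Rf_def algebra_simps)

lemma skew_remainders_0 [simp]: "0 \<in> skew_remainders f"
  by (simp add: skew_remainders_def)

lemma skew_remainders_iff: "v \<in> skew_remainders f \<longleftrightarrow> degree v < degree f"
  using degree_f_pos by (auto simp: skew_remainders_def)

lemma skew_mod_eq_0_iff: "skew_mod \<sigma> g f = 0 \<longleftrightarrow> g \<in> Rf"
  using skew_mod_diff_in_Rf[of g] skew_mod_eqI'[of 0 g] by auto

lemma skew_mod_cong: "g - g' \<in> Rf \<Longrightarrow> skew_mod \<sigma> g f = skew_mod \<sigma> g' f"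
  using Rf_add[of "g - g'" "g' - skew_mod \<sigma> g' f"] skew_mod_diff_in_Rf[of g'] skew_mod_in_remainders
  by (intro skew_mod_eqI') auto

lemma skew_mod_self: "v \<in> skew_remainders f \<Longrightarrow> skew_mod \<sigma> v f = v"
  by (rule skew_mod_eqI[of _ _ _ 0]) simp_all

lemma skew_mod_mult_mod: "skew_mod \<sigma> (u \<star> skew_mod \<sigma> g f) f = skew_mod \<sigma> (u \<star> g) f"
  using Rf_mult[OF skew_mod_diff_in_Rf[of g], of u]
  by (intro skew_mod_cong[symmetric]) (simp add: skew_mult_diff)

lemma skew_mod_add: "skew_mod \<sigma> (g + g') f = skew_mod \<sigma> g f + skew_mod \<sigma> g' f"
  using Rf_add[OF skew_mod_diff_in_Rf[of g] skew_mod_diff_in_Rf[of g']]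
    skew_mod_in_remainders[of g] skew_mod_in_remainders[of g']
  by (intro skew_mod_eqI') (auto simp: skew_remainders_iff algebra_simps intro: degree_add_less)

lemma skew_mod_smult: "skew_mod \<sigma> (Polynomial.smult c g) f = Polynomial.smult c (skew_mod \<sigma> g f)"
  using skew_mod_in_remainders[of g] Rf_mult[OF skew_mod_diff_in_Rf[of g], of "[:c:]"]
  by (intro skew_mod_eqI') (auto simp: skew_remainders_iff const_skew_mult smult_diff_right
    intro: le_less_trans[OF degree_smult_le])

lemma skew_mod_sum: "skew_mod \<sigma> (sum g A) f = (\<Sum>a\<in>A. skew_mod \<sigma> (g a) f)"
  by (induction A rule: infinite_finite_induct) (auto simp: skew_mod_add skew_mod_self)

abbreviation \<phi> where "\<phi> \<equiv> phi \<sigma> f"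

lemma phi_funpow: "v \<in> skew_remainders f \<Longrightarrow> (\<phi> ^^ k) v = skew_mod \<sigma> (monom 1 k \<star> v) f"
proof (induction k)
  case 0
  then show ?case using skew_mult_1(1)[of v] by (simp add: skew_mod_self)
next
  case (Suc k)
  have "(\<phi> ^^ Suc k) v = \<phi> (skew_mod \<sigma> (monom 1 k \<star> v) f)"
    using Suc by simp
  also have "\<dots> = skew_mod \<sigma> (monom 1 1 \<star> skew_mod \<sigma> (monom 1 k \<star> v) f) f"
    by (rule phi_def)
  also have "\<dots> = skew_mod \<sigma> ((monom 1 1 \<star> monom 1 k) \<star> v) f"
    by (simp only: skew_mod_mult_mod skew_mult_assoc)
  finally show ?case by (simp add: skew_mult_monom)
qed

text \<open>Turns linear algebra into ring theory: \<open>\<phi>\<^sup>n\<close> is left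
  multiplication by \<open>x\<^sup>n\<close> modulo \<open>f\<close>, so a polynomial
  \<open>p\<close> in it is left multiplication by \<open>p(x\<^sup>n)\<close>.\<close>

lemma poly_map_apply_phi:
  assumes "v \<in> skew_remainders f"
  shows "poly_map_apply Polynomial.smult p (\<phi> ^^ n) v = skew_mod \<sigma> ((p \<circ>\<^sub>p monom 1 n) \<star> v) f"
proof -
  have "poly_map_apply Polynomial.smult p (\<phi> ^^ n) v
      = (\<Sum>i\<le>degree p. Polynomial.smult (coeff p i) ((\<phi> ^^ (n * i)) v))"
    by (simp add: poly_map_apply_def flip: funpow_mult)
  also have "\<dots> = (\<Sum>i\<le>degree p. skew_mod \<sigma> (monom (coeff p i) (n * i) \<star> v) f)"
    by (simp add: phi_funpow[OF assms] smult_monom flip: skew_mod_smult smult_skew_mult)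
  also have "\<dots> = skew_mod \<sigma> ((\<Sum>i\<le>degree p. monom (coeff p i) (n * i)) \<star> v) f"
  proof -
    have "sum g A \<star> v = (\<Sum>a\<in>A. g a \<star> v)" for g and A :: "nat set"
      by (induction A rule: infinite_finite_induct) (auto simp: skew_mult_distrib)
    then show ?thesis by (simp add: skew_mod_sum)
  qed
  also have "(\<Sum>i\<le>degree p. monom (coeff p i) (n * i)) = (\<Sum>i\<le>degree p. monom (coeff p i) i) \<circ>\<^sub>p monom 1 n"
    by (simp add: pcompose_sum subst_monom)
  finally show ?thesis by (simp add: poly_as_sum_of_monoms)
qed

text \<open>\<open>v\<close> ranges over the whole ring, not only over remainders, to match the
  annihilator ideal of \<open>R / R f\<close>.\<close>

definition annihilates :: "'l poly \<Rightarrow> bool" where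
  "annihilates p \<longleftrightarrow> (\<forall>v. (p \<circ>\<^sub>p monom 1 n) \<star> v \<in> Rf)"

lemma annihilates_iff:
  "(\<forall>v\<in>skew_remainders f. poly_map_apply Polynomial.smult p (\<phi> ^^ n) v = 0) \<longleftrightarrow> annihilates p"
proof
  assume *: "\<forall>v\<in>skew_remainders f. poly_map_apply Polynomial.smult p (\<phi> ^^ n) v = 0"
  show "annihilates p"
    unfolding annihilates_def
  proof
    fix v
    have "skew_mod \<sigma> ((p \<circ>\<^sub>p monom 1 n) \<star> v) f = 0"
      using * skew_mod_in_remainders[of v] skew_mod_mult_mod[of "p \<circ>\<^sub>p monom 1 n" v]
      by (simp add: poly_map_apply_phi)
    then show "(p \<circ>\<^sub>p monom 1 n) \<star> v \<in> Rf" by (simp add: skew_mod_eq_0_iff)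
  qed
qed (auto simp: annihilates_def poly_map_apply_phi skew_mod_eq_0_iff)

lemma annihilates_diff: "annihilates p \<Longrightarrow> annihilates q \<Longrightarrow> annihilates (p - q)"
  by (auto simp: annihilates_def pcompose_diff skew_mult_diff Rf_diff)

lemma annihilates_degree: "annihilates p \<Longrightarrow> p \<noteq> 0 \<Longrightarrow> degree F \<le> degree p"
  using annihilator_degree[of "p \<circ>\<^sub>p monom 1 n"] n_pos
  unfolding annihilates_def degree_subst subst_eq_0_iff by simp

lemma annihilates_F: "annihilates (map_poly \<iota> F)"
  using Z_Rf_mult[OF Z_F_in_Rf] by (auto simp: annihilates_def central_poly_eq_subst)

lemma min_poly_phi: "min_poly Polynomial.smult (skew_remainders f) (\<phi> ^^ n) = map_poly \<iota> F"
proof (rule min_poly_eqI)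
  fix q assume "\<forall>v\<in>skew_remainders f. poly_map_apply Polynomial.smult q (\<phi> ^^ n) v = 0"
  then show "\<forall>v\<in>skew_remainders f. poly_map_apply Polynomial.smult (map_poly \<iota> F - q) (\<phi> ^^ n) v = 0"
    unfolding annihilates_iff using annihilates_F by (rule annihilates_diff[rotated])
next
  fix q :: "'l poly"
  assume "q \<noteq> 0" "\<forall>v\<in>skew_remainders f. poly_map_apply Polynomial.smult q (\<phi> ^^ n) v = 0"
  then show "degree (map_poly \<iota> F) \<le> degree q"
    unfolding annihilates_iff using annihilates_degree by simp
qed (use annihilates_F F_monic annihilates_iff in auto)

lemma poly_map_apply_iota:
  "poly_map_apply (\<lambda>c. Polynomial.smult (\<iota> c)) p T v = poly_map_apply Polynomial.smult (map_poly \<iota> p) T v"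
  by (simp add: poly_map_apply_def)

text \<open>Embedding a polynomial over the small field changes neither its action nor its degree,
  so the degree bound for annihilators over the large field applies.\<close>

lemma min_poly_phi_iota:
  "min_poly (\<lambda>c. Polynomial.smult (\<iota> c)) (skew_remainders f) (\<phi> ^^ n) = F"
proof (rule min_poly_eqI)
  fix q assume "\<forall>v\<in>skew_remainders f. poly_map_apply (\<lambda>c. Polynomial.smult (\<iota> c)) q (\<phi> ^^ n) v = 0"
  then show "\<forall>v\<in>skew_remainders f. poly_map_apply (\<lambda>c. Polynomial.smult (\<iota> c)) (F - q) (\<phi> ^^ n) v = 0"
    unfolding poly_map_apply_iota annihilates_iff iota_poly.hom_minus
    using annihilates_F by (rule annihilates_diff[rotated])
next
  fix q :: "'k poly"
  assume "q \<noteq> 0" "\<forall>v\<in>skew_remainders f. poly_map_apply (\<lambda>c. Polynomial.smult (\<iota> c)) q (\<phi> ^^ n) v = 0"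
  then show "degree F \<le> degree q"
    unfolding poly_map_apply_iota annihilates_iff using annihilates_degree[of "map_poly \<iota> q"] by simp
qed (use annihilates_F F_monic annihilates_iff poly_map_apply_iota in auto)

section \<open>The characteristic polynomial\<close>

definition coords :: "'l poly \<Rightarrow> 'l vec" where "coords v = vec (degree f) (coeff v)"

lemma coords_carrier [simp]: "coords v \<in> carrier_vec (degree f)"
  by (simp add: coords_def)

abbreviation "Cf \<equiv> companion_matrix f"
abbreviation "A \<equiv> A_mat n \<sigma> f"

lemma Cf_carrier [simp]: "Cf \<in> carrier_mat (degree f) (degree f)"
  by (simp add: companion_matrix_def)

lemma Cf_mult_index:
  assumes "w \<in> carrier_vec (degree f)" "i < degree f"
  shows "(Cf *\<^sub>v w) $ i = (if i = 0 then 0 else w $ (i - 1)) - coeff f i * w $ (degree f - 1)"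
proof -
  let ?h = "degree f"
  have "(Cf *\<^sub>v w) $ i = (\<Sum>j<?h. (if j = ?h - 1 then - coeff f i else if i = j + 1 then 1 else 0) * w $ j)"
    using assms by (simp add: companion_matrix_def scalar_prod_def atLeast0LessThan)
  also have "\<dots> = (\<Sum>j<?h. (if j = ?h - 1 then - coeff f i * w $ (?h - 1) else 0)
      + (if j = i - 1 then (if i = 0 then 0 else w $ (i - 1)) else 0))"
    using assms(2) by (intro sum.cong) auto
  also have "\<dots> = (if i = 0 then 0 else w $ (i - 1)) - coeff f i * w $ (?h - 1)"
    using assms(2) by (simp add: sum.distrib)
  finally show ?thesis .
qed

lemma degree_less_iff: "degree v < degree f \<longleftrightarrow> (\<forall>i\<ge>degree f. coeff v i = 0)"
  using degree_f_pos by (metis coeff_eq_0 degree_0 leading_coeff_0_iff not_le order_less_le_trans)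

lemma coords_phi:
  assumes "v \<in> skew_remainders f"
  shows "coords (\<phi> v) = Cf *\<^sub>v map_vec \<sigma> (coords v)"
proof -
  let ?h = "degree f"
  \<comment> \<open>The degree of \<open>x v\<close> is at most that of \<open>f\<close>, so
    subtracting one constant multiple of \<open>f\<close> yields the remainder.\<close>
  define r where "r = pCons 0 (map_poly \<sigma> v) - Polynomial.smult (\<sigma> (coeff v (?h - 1))) f"
  have coeff_r: "coeff r i = (if i = 0 then 0 else \<sigma> (coeff v (i - 1))) - coeff f i * \<sigma> (coeff v (?h - 1))" for i
    by (simp add: r_def coeff_pCons split: nat.splits)
  have "coeff r i = 0" if "i \<ge> ?h" for i
  proof (cases "i = ?h")
    case True
    then show ?thesis using degree_f_pos monic by (simp add: coeff_r)
  next
    case False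
    with that assms have "coeff f i = 0" "coeff v (i - 1) = 0"
      by (auto simp: skew_remainders_iff intro!: coeff_eq_0)
    then show ?thesis by (simp add: coeff_r)
  qed
  then have "r \<in> skew_remainders f" unfolding skew_remainders_iff degree_less_iff by blast
  moreover have "monom 1 1 \<star> v - r = [:\<sigma> (coeff v (?h - 1)):] \<star> f"
    by (simp only: r_def monom_1_skew_mult const_skew_mult) simp
  then have "monom 1 1 \<star> v - r \<in> Rf" by (auto simp: Rf_def)
  ultimately have "\<phi> v = r" unfolding phi_def by (rule skew_mod_eqI')
  moreover have "(Cf *\<^sub>v map_vec \<sigma> (coords v)) $ i = coeff r i" if "i < ?h" for i
    using that degree_f_pos
    by (subst Cf_mult_index) (auto simp: coeff_r coords_def)
  ultimately show ?thesis
    by (intro eq_vecI) (auto simp: coords_def companion_matrix_def simp del: index_mult_mat_vec)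
qed

lemma A_mat_Suc: "A_mat (Suc k) \<sigma> f = A_mat k \<sigma> f * map_mat (\<sigma> ^^ k) Cf"
  and A_mat_carrier [simp]: "A_mat k \<sigma> f \<in> carrier_mat (degree f) (degree f)"
proof -
  have c: "\<forall>X\<in>set (map (\<lambda>i. map_mat (\<sigma> ^^ i) Cf) [0..<k]). X \<in> carrier_mat (degree f) (degree f)"
    by simp
  show "A_mat k \<sigma> f \<in> carrier_mat (degree f) (degree f)"
    unfolding A_mat_def using foldr_mult_mat[OF c, of "1\<^sub>m (degree f)"] by simp
  show "A_mat (Suc k) \<sigma> f = A_mat k \<sigma> f * map_mat (\<sigma> ^^ k) Cf"
    unfolding A_mat_def using foldr_mult_mat[OF c, of "map_mat (\<sigma> ^^ k) Cf"]
    by (simp add: right_mult_one_mat[of _ "degree f" "degree f"])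
qed

lemma dim_A_mat [simp]: "dim_row (A_mat k \<sigma> f) = degree f" "dim_col (A_mat k \<sigma> f) = degree f"
  using carrier_matD[OF A_mat_carrier[of k]] by auto

lemma char_poly_matrix_A [simp]: "char_poly_matrix A \<in> carrier_mat (degree f) (degree f)"
  by simp

text \<open>Semilinearity adds one twist per application. Peeling off the innermost
  \<open>\<phi>\<close> makes the new factor appear on the right of the product, as in
  \<open>A_mat_Suc\<close>.\<close>

lemma coords_phi_funpow:
  "v \<in> skew_remainders f \<Longrightarrow> coords ((\<phi> ^^ k) v) = A_mat k \<sigma> f *\<^sub>v map_vec (\<sigma> ^^ k) (coords v)"
proof (induction k arbitrary: v)
  case 0
  have "map_vec (\<lambda>a. a) (coords v) = coords v" by (intro eq_vecI) auto
  then show ?case by (simp add: A_mat_def id_def)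
next
  case (Suc k)
  interpret h: field_hom "\<sigma> ^^ k" by (rule field_hom_funpow)
  have "coords ((\<phi> ^^ Suc k) v) = A_mat k \<sigma> f *\<^sub>v map_vec (\<sigma> ^^ k) (coords (\<phi> v))"
    unfolding funpow_Suc_right comp_apply
    by (rule Suc.IH) (simp add: phi_def skew_mod_in_remainders)
  also have "map_vec (\<sigma> ^^ k) (coords (\<phi> v))
      = map_mat (\<sigma> ^^ k) Cf *\<^sub>v map_vec (\<sigma> ^^ k) (map_vec \<sigma> (coords v))"
    unfolding coords_phi[OF Suc.prems]
    by (rule h.mult_mat_vec_hom[where nr = "degree f" and n = "degree f"]) auto
  also have "map_vec (\<sigma> ^^ k) (map_vec \<sigma> (coords v)) = map_vec (\<sigma> ^^ Suc k) (coords v)"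
    by (intro eq_vecI) (auto simp: funpow_swap1)
  also have "A_mat k \<sigma> f *\<^sub>v (map_mat (\<sigma> ^^ k) Cf *\<^sub>v map_vec (\<sigma> ^^ Suc k) (coords v))
      = A_mat (Suc k) \<sigma> f *\<^sub>v map_vec (\<sigma> ^^ Suc k) (coords v)"
    unfolding A_mat_Suc by (rule assoc_mult_mat_vec[symmetric, of _ "degree f" "degree f" _ "degree f"]) auto
  finally show ?case .
qed

lemma coords_phi_funpow_n:
  assumes "v \<in> skew_remainders f"
  shows "coords ((\<phi> ^^ n) v) = A *\<^sub>v coords v"
proof -
  have "map_vec (\<sigma> ^^ n) (coords v) = coords v" by (intro eq_vecI) auto
  then show ?thesis using coords_phi_funpow[OF assms, of n] by simp
qed

lemma matrix_of_phi_funpow: "matrix_of_map (degree f) (\<phi> ^^ n) = A"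
proof (rule eq_matI)
  fix i j assume "i < dim_row A" "j < dim_col A"
  then have ij: "i < degree f" "j < degree f" using A_mat_carrier[of n] by auto
  have "coords (monom 1 j) = unit_vec (degree f) j"
    by (intro eq_vecI) (auto simp: coords_def unit_vec_def)
  moreover have "monom 1 j \<in> skew_remainders f"
    using ij by (simp add: skew_remainders_iff degree_monom_eq)
  ultimately have "coords ((\<phi> ^^ n) (monom 1 j)) = A *\<^sub>v unit_vec (degree f) j"
    using coords_phi_funpow_n by simp
  from arg_cong[OF this, of "\<lambda>w. w $ i"] show "matrix_of_map (degree f) (\<phi> ^^ n) $$ (i, j) = A $$ (i, j)"
    using ij A_mat_carrier[of n] by (simp add: matrix_of_map_def coords_def carrier_matD)
qed (use A_mat_carrier[of n] in \<open>auto simp: matrix_of_map_def\<close>)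

section \<open>Conjugation by the companion matrix\<close>

text \<open>For a kernel vector, row \<open>0\<close> and the nonzero constant coefficient of
  \<open>f\<close> make the last coordinate vanish; each later row then kills the coordinate before
  it.\<close>

lemma det_Cf: "det Cf \<noteq> 0"
proof
  assume "det Cf = 0"
  then obtain w where w: "w \<in> carrier_vec (degree f)" "w \<noteq> 0\<^sub>v (degree f)" "Cf *\<^sub>v w = 0\<^sub>v (degree f)"
    using det_0_iff_vec_prod_zero[OF Cf_carrier] by auto
  have z: "(if i = 0 then 0 else w $ (i - 1)) - coeff f i * w $ (degree f - 1) = 0" if "i < degree f" for i
    using Cf_mult_index[OF w(1) that] w(3) that by simp
  have last: "w $ (degree f - 1) = 0" using z[OF degree_f_pos] coeff_f_0 by simp
  have "w = 0\<^sub>v (degree f)"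
  proof (rule eq_vecI)
    fix i assume "i < dim_vec (0\<^sub>v (degree f) :: 'l vec)"
    then have i: "i < degree f" by simp
    show "w $ i = 0\<^sub>v (degree f) $ i"
    proof (cases "Suc i < degree f")
      case True
      then show ?thesis using z[of "Suc i"] last i by simp
    next
      case False
      then have "i = degree f - 1" using i by simp
      then show ?thesis using last i by simp
    qed
  qed (use w in auto)
  then show False using w by simp
qed

text \<open>Applying \<open>\<sigma>\<close> raises every exponent in the product by one, and the
  left factor restores the exponent \<open>0\<close>.\<close>

lemma Cf_mult_A_mat: "Cf * map_mat \<sigma> (A_mat k \<sigma> f) = A_mat (Suc k) \<sigma> f"
proof (induction k)
  case 0
  have "map_mat \<sigma> (1\<^sub>m (degree f)) = 1\<^sub>m (degree f)" by (intro eq_matI) auto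
  moreover have "map_mat (\<lambda>a. a) Cf = Cf" by (intro eq_matI) auto
  ultimately show ?case
    using Cf_carrier by (simp add: A_mat_def id_def right_mult_one_mat[OF Cf_carrier])
next
  case (Suc k)
  have *: "map_mat \<sigma> (map_mat (\<sigma> ^^ k) Cf) = map_mat (\<sigma> ^^ Suc k) Cf"
    by (intro eq_matI) auto
  have "map_mat \<sigma> (A_mat (Suc k) \<sigma> f) = map_mat \<sigma> (A_mat k \<sigma> f) * map_mat \<sigma> (map_mat (\<sigma> ^^ k) Cf)"
    unfolding A_mat_Suc by (rule mat_hom_mult[where nr = "degree f" and n = "degree f" and nc = "degree f"]) auto
  then have "Cf * map_mat \<sigma> (A_mat (Suc k) \<sigma> f)
      = Cf * map_mat \<sigma> (A_mat k \<sigma> f) * map_mat (\<sigma> ^^ Suc k) Cf"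
    unfolding * by (simp add: assoc_mult_mat[of _ "degree f" "degree f" _ "degree f" _ "degree f"])
  then show ?case unfolding Suc.IH by (simp only: A_mat_Suc[of "Suc k"])
qed

lemma char_poly_A_fixed: "map_poly \<sigma> (char_poly A) = char_poly A"
proof -
  have "map_mat (\<sigma> ^^ n) Cf = Cf" by (intro eq_matI) auto
  \<comment> \<open>The product with \<open>n + 1\<close> factors is split at either end; its last
    factor is \<open>Cf\<close> itself because \<open>\<sigma>\<^sup>n = id\<close>.\<close>
  then have AC: "A * Cf = Cf * map_mat \<sigma> A"
    using Cf_mult_A_mat[of n] by (simp add: A_mat_Suc)
  obtain D where D: "D \<in> carrier_mat (degree f) (degree f)" "Cf * D = 1\<^sub>m (degree f)" "D * Cf = 1\<^sub>m (degree f)"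
    using det_non_zero_imp_unit[OF Cf_carrier det_Cf] by (auto simp: Units_def ring_mat_def)
  have "A = A * (Cf * D)" using D right_mult_one_mat[OF A_mat_carrier] by simp
  also have "\<dots> = A * Cf * D" using D by (simp add: assoc_mult_mat[of _ "degree f" "degree f" _ "degree f" _ "degree f"])
  finally have "A = Cf * map_mat \<sigma> A * D" by (simp only: AC)
  then have "similar_mat A (map_mat \<sigma> A)"
    by (intro similar_matI[of _ _ Cf D "degree f"]) (use D in auto)
  then have "char_poly A = char_poly (map_mat \<sigma> A)" by (rule char_poly_similar)
  also have "\<dots> = map_poly \<sigma> (char_poly A)" by (rule char_poly_hom[OF A_mat_carrier])
  finally show ?thesis by simp
qed

text \<open>The remainder theorem \<open>p(y) - p(A) = (y - A) B\<close> for the matrix \<open>A\<close> of \<open>\<phi>\<^sup>n\<close>.\<close>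

lemma char_poly_matrix_factor:
  fixes p :: "'l poly"
  defines "h \<equiv> degree f"
  shows "\<exists>B P. B \<in> carrier_mat h h \<and> P \<in> carrier_mat h h \<and>
    p \<cdot>\<^sub>m 1\<^sub>m h = map_mat (\<lambda>a. [:a:]) P + char_poly_matrix A * B \<and>
    (\<forall>v\<in>skew_remainders f. coords (skew_mod \<sigma> ((p \<circ>\<^sub>p monom 1 n) \<star> v) f) = P *\<^sub>v coords v)"
proof (induction p)
  case 0
  have "coords 0 = 0\<^sub>m h h *\<^sub>v coords v" for v
    by (intro eq_vecI) (auto simp: coords_def h_def)
  moreover have "0 \<cdot>\<^sub>m 1\<^sub>m h = map_mat (\<lambda>a. [:a:]) (0\<^sub>m h h :: 'l mat) + char_poly_matrix A * 0\<^sub>m h h"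
    unfolding h_def right_mult_zero_mat[OF char_poly_matrix_A] by (intro eq_matI) auto
  ultimately show ?case by (intro exI[of _ "0\<^sub>m h h"]) (simp add: skew_mod_self)
next
  case (pCons a p)
  then obtain B P where B: "B \<in> carrier_mat h h" and P: "P \<in> carrier_mat h h"
    and fact: "p \<cdot>\<^sub>m 1\<^sub>m h = map_mat (\<lambda>a. [:a:]) P + char_poly_matrix A * B"
    and act: "\<And>v. v \<in> skew_remainders f \<Longrightarrow>
      coords (skew_mod \<sigma> ((p \<circ>\<^sub>p monom 1 n) \<star> v) f) = P *\<^sub>v coords v"
    by blast
  define M where "M = map_mat (\<lambda>a. [:a:]) A"
  define X where "X = char_poly_matrix A"
  define Pm where "Pm = map_mat (\<lambda>a. [:a:]) P"
  have A: "A \<in> carrier_mat h h" by (simp add: h_def)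
  have c [simp]: "M \<in> carrier_mat h h" "X \<in> carrier_mat h h" "Pm \<in> carrier_mat h h" "B \<in> carrier_mat h h"
    using A B P by (simp_all add: M_def X_def Pm_def)
  have MB [simp]: "M * B \<in> carrier_mat h h" by (rule mult_carrier_mat[OF c(1,4)])
  have XB [simp]: "X * B \<in> carrier_mat h h" by (rule mult_carrier_mat[OF c(2,4)])
  interpret const: comm_ring_hom "\<lambda>a :: 'l. [:a:]" by unfold_locales (auto simp: one_pCons)
  note assoc = assoc_mult_mat[of _ h h _ h _ h]
  have X: "X = [:0, 1:] \<cdot>\<^sub>m 1\<^sub>m h + (- 1) \<cdot>\<^sub>m M"
    using A by (intro eq_matI) (auto simp: X_def M_def char_poly_matrix_def)
  have XM: "X * M = M * X"
  proof -
    have "X * M = ([:0, 1:] \<cdot>\<^sub>m 1\<^sub>m h) * M + ((- 1) \<cdot>\<^sub>m M) * M"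
      unfolding X by (rule add_mult_distrib_mat[of _ h h _ _ h]) auto
    also have "\<dots> = M * ([:0, 1:] \<cdot>\<^sub>m 1\<^sub>m h) + M * ((- 1) \<cdot>\<^sub>m M)"
      by (simp add: mult_smult_assoc_mat[of _ h h _ h] mult_smult_distrib[of _ h h _ h]
          left_mult_one_mat[OF c(1)] right_mult_one_mat[OF c(1)])
    also have "\<dots> = M * X"
      unfolding X by (rule mult_add_distrib_mat[symmetric, of _ h h _ h]) auto
    finally show ?thesis .
  qed
  have "M * (p \<cdot>\<^sub>m 1\<^sub>m h) = M * Pm + M * (X * B)"
    unfolding fact Pm_def[symmetric] X_def[symmetric] by (subst mult_add_distrib_mat[of _ h h _ h]) auto
  moreover have "M * (p \<cdot>\<^sub>m 1\<^sub>m h) = p \<cdot>\<^sub>m M"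
    by (simp add: mult_smult_distrib[of _ h h _ h] right_mult_one_mat[OF c(1)])
  ultimately have 1: "p \<cdot>\<^sub>m M = M * Pm + M * (X * B)" by simp
  have "X * (p \<cdot>\<^sub>m 1\<^sub>m h + M * B) = X * (p \<cdot>\<^sub>m 1\<^sub>m h) + X * (M * B)"
    by (rule mult_add_distrib_mat[of _ h h _ h]) auto
  also have "X * (p \<cdot>\<^sub>m 1\<^sub>m h) = p \<cdot>\<^sub>m X"
    by (simp add: mult_smult_distrib[of _ h h _ h] right_mult_one_mat[OF c(2)])
  also have "X * (M * B) = M * (X * B)"
    using XM by (simp flip: assoc)
  finally have 2: "X * (p \<cdot>\<^sub>m 1\<^sub>m h + M * B) = p \<cdot>\<^sub>m X + M * (X * B)" .
  have MP: "map_mat (\<lambda>a. [:a:]) (A * P) = M * Pm"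
    unfolding M_def Pm_def by (rule const.mat_hom_mult[OF A P])
  \<comment> \<open>Since \<open>X\<close> is \<open>y - M\<close> and commutes with
    \<open>M\<close>, multiplying \<open>p = P + X B\<close> by \<open>y = X + M\<close> gives
    \<open>M P + X (p + M B)\<close>. This dictates both witnesses.\<close>
  have "pCons a p \<cdot>\<^sub>m 1\<^sub>m h = map_mat (\<lambda>a. [:a:]) (a \<cdot>\<^sub>m 1\<^sub>m h + A * P) + X * (p \<cdot>\<^sub>m 1\<^sub>m h + M * B)"
  proof (rule eq_matI)
    fix i j
    assume "i < dim_row (map_mat (\<lambda>a. [:a:]) (a \<cdot>\<^sub>m 1\<^sub>m h + A * P) + X * (p \<cdot>\<^sub>m 1\<^sub>m h + M * B))"
      and "j < dim_col (map_mat (\<lambda>a. [:a:]) (a \<cdot>\<^sub>m 1\<^sub>m h + A * P) + X * (p \<cdot>\<^sub>m 1\<^sub>m h + M * B))"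
    then have ij: "i < h" "j < h" using c(2,4) A P by (auto simp del: c)
    have e1: "p * M $$ (i, j) = (M * Pm) $$ (i, j) + (M * (X * B)) $$ (i, j)"
      using arg_cong[OF 1, of "\<lambda>Y. Y $$ (i, j)"] ij c by (simp del: index_mult_mat(1))
    have e2: "X $$ (i, j) = (if i = j then [:0, 1:] else 0) - M $$ (i, j)"
      using ij by (simp add: X carrier_matD[OF c(1)])
    have e3: "[:(A * P) $$ (i, j):] = (M * Pm) $$ (i, j)"
      using arg_cong[OF MP, of "\<lambda>Y. Y $$ (i, j)"] ij P by (simp add: h_def del: index_mult_mat(1))
    have e4: "(X * (p \<cdot>\<^sub>m 1\<^sub>m h + M * B)) $$ (i, j) = p * X $$ (i, j) + (M * (X * B)) $$ (i, j)"
      unfolding 2 using ij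
      by (simp add: carrier_matD[OF c(1)] carrier_matD[OF c(2)] carrier_matD[OF c(4)] del: index_mult_mat(1))
    have "(map_mat (\<lambda>a. [:a:]) (a \<cdot>\<^sub>m 1\<^sub>m h + A * P) + X * (p \<cdot>\<^sub>m 1\<^sub>m h + M * B)) $$ (i, j)
       = [:(if i = j then a else 0) + (A * P) $$ (i, j):] + (X * (p \<cdot>\<^sub>m 1\<^sub>m h + M * B)) $$ (i, j)"
      using ij P c by (simp add: h_def del: index_mult_mat(1))
    also have "\<dots> = [:if i = j then a else 0:] + (M * Pm) $$ (i, j) + (p * X $$ (i, j) + (M * (X * B)) $$ (i, j))"
      unfolding e4 e3[symmetric] by simp
    also have "\<dots> = [:if i = j then a else 0:] + p * (if i = j then [:0, 1:] else 0)"
      using e1 unfolding e2 by (simp add: algebra_simps)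
    also have "\<dots> = (pCons a p \<cdot>\<^sub>m 1\<^sub>m h) $$ (i, j)"
      using ij by simp
    finally show "(pCons a p \<cdot>\<^sub>m 1\<^sub>m h) $$ (i, j)
      = (map_mat (\<lambda>a. [:a:]) (a \<cdot>\<^sub>m 1\<^sub>m h + A * P) + X * (p \<cdot>\<^sub>m 1\<^sub>m h + M * B)) $$ (i, j)" ..
  qed (use carrier_matD[OF c(2)] carrier_matD[OF B] in auto)
  moreover have "coords (skew_mod \<sigma> ((pCons a p \<circ>\<^sub>p monom 1 n) \<star> v) f) = (a \<cdot>\<^sub>m 1\<^sub>m h + A * P) *\<^sub>v coords v"
    if v: "v \<in> skew_remainders f" for v
  proof -
    have coords_add: "coords (u + w) = coords u + coords w" for u w
      by (intro eq_vecI) (auto simp: coords_def)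
    have coords_smult: "coords (Polynomial.smult a u) = a \<cdot>\<^sub>v coords u" for u
      by (intro eq_vecI) (auto simp: coords_def)
    have "monom 1 n * (p \<circ>\<^sub>p monom 1 n) = monom 1 n \<star> (p \<circ>\<^sub>p monom 1 n)"
      using subst_skew_mult[of "monom 1 1" "p \<circ>\<^sub>p monom 1 n"] by (simp add: subst_monom)
    then have "(pCons a p \<circ>\<^sub>p monom 1 n) \<star> v = Polynomial.smult a v + monom 1 n \<star> ((p \<circ>\<^sub>p monom 1 n) \<star> v)"
      by (simp add: pcompose_pCons skew_mult_distrib const_skew_mult skew_mult_assoc)
    then have "skew_mod \<sigma> ((pCons a p \<circ>\<^sub>p monom 1 n) \<star> v) f
      = Polynomial.smult a v + (\<phi> ^^ n) (skew_mod \<sigma> ((p \<circ>\<^sub>p monom 1 n) \<star> v) f)"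
      by (simp add: skew_mod_add skew_mod_smult skew_mod_self[OF v]
          phi_funpow[OF skew_mod_in_remainders] skew_mod_mult_mod)
    then have "coords (skew_mod \<sigma> ((pCons a p \<circ>\<^sub>p monom 1 n) \<star> v) f)
      = a \<cdot>\<^sub>v coords v + A *\<^sub>v (P *\<^sub>v coords v)"
      by (simp add: coords_add coords_smult coords_phi_funpow_n[OF skew_mod_in_remainders] act[OF v])
    also have "\<dots> = (a \<cdot>\<^sub>m 1\<^sub>m h + A * P) *\<^sub>v coords v"
    proof -
      have cv: "coords v \<in> carrier_vec h" by (simp add: h_def)
      have "(a \<cdot>\<^sub>m 1\<^sub>m h + A * P) *\<^sub>v coords v = (a \<cdot>\<^sub>m 1\<^sub>m h) *\<^sub>v coords v + (A * P) *\<^sub>v coords v"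
        using A P cv by (intro add_mult_distrib_mat_vec[of _ h h]) auto
      moreover have "(a \<cdot>\<^sub>m 1\<^sub>m h) *\<^sub>v coords v = a \<cdot>\<^sub>v coords v"
        using cv by (intro eq_vecI) (auto simp: scalar_prod_def if_distrib if_distribR cong: if_cong)
      ultimately show ?thesis using assoc_mult_mat_vec[OF A P cv] by simp
    qed
    finally show ?thesis .
  qed
  ultimately show ?case
    using A P unfolding X_def by (intro exI[of _ "p \<cdot>\<^sub>m 1\<^sub>m h + M * B"] exI[of _ "a \<cdot>\<^sub>m 1\<^sub>m h + A * P"]) auto
qed

text \<open>For \<open>F\<close> the matrix \<open>P\<close> represents
  \<open>F(\<phi>\<^sup>n) = 0\<close>, so \<open>F\<close> times the identity is a multiple of the
  characteristic matrix; determinants give the claim.\<close>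

lemma char_poly_A_dvd: "char_poly A dvd map_poly \<iota> F ^ degree f"
proof -
  let ?h = "degree f" and ?F = "map_poly \<iota> F"
  obtain B P where B: "B \<in> carrier_mat ?h ?h" and P: "P \<in> carrier_mat ?h ?h"
    and fact: "?F \<cdot>\<^sub>m 1\<^sub>m ?h = map_mat (\<lambda>a. [:a:]) P + char_poly_matrix A * B"
    and act: "\<And>v. v \<in> skew_remainders f \<Longrightarrow>
      coords (skew_mod \<sigma> ((?F \<circ>\<^sub>p monom 1 n) \<star> v) f) = P *\<^sub>v coords v"
    using char_poly_matrix_factor[of ?F] by blast
  have "P $$ (i, j) = 0" if ij: "i < ?h" "j < ?h" for i j
  proof -
    have "coords (monom 1 j) = unit_vec ?h j"
      by (intro eq_vecI) (auto simp: coords_def unit_vec_def)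
    moreover have "monom 1 j \<in> skew_remainders f"
      using ij by (simp add: skew_remainders_iff degree_monom_eq)
    moreover have "skew_mod \<sigma> ((?F \<circ>\<^sub>p monom 1 n) \<star> v) f = 0" for v
      using annihilates_F by (simp add: annihilates_def skew_mod_eq_0_iff)
    ultimately have "coords 0 = P *\<^sub>v unit_vec ?h j" using act[of "monom 1 j"] by simp
    from arg_cong[OF this, of "\<lambda>w. w $ i"] show ?thesis using ij P by (simp add: coords_def)
  qed
  then have "map_mat (\<lambda>a. [:a:]) P = 0\<^sub>m ?h ?h" using P by (intro eq_matI) auto
  then have "?F \<cdot>\<^sub>m 1\<^sub>m ?h = char_poly_matrix A * B"
    unfolding fact using mult_carrier_mat[OF char_poly_matrix_A B] by (simp add: left_add_zero_mat)
  from arg_cong[OF this, of det] have "?F ^ ?h = char_poly A * det B"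
    using B A_mat_carrier[of n] by (simp add: char_poly_def det_mult[of _ ?h])
  then show ?thesis by simp
qed

text \<open>The divisibility is first brought down to the small field, since \<open>F\<close> is
  known to be irreducible only there.\<close>

lemma char_poly_A_eq_power:
  "\<exists>k. char_poly A = map_poly \<iota> F ^ k \<and> degree f = k * degree F"
proof -
  have deg: "degree (char_poly A) = degree f" "monic (char_poly A)"
    using degree_monic_char_poly[OF A_mat_carrier] by auto
  obtain p where p: "char_poly A = map_poly \<iota> p" using ex_map_poly_iota[OF char_poly_A_fixed] by blast
  have "p dvd F ^ degree f"
    using char_poly_A_dvd unfolding p by (intro iota.dvd_map_poly_hom_imp_dvd) (simp add: iota_poly.hom_power)
  moreover have "lead_coeff p = 1" using deg(2) unfolding p by simp
  ultimately obtain k where "p = F ^ k"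
    using monic_dvd_irreducible_power[OF degree_F_pos F_irreducible F_monic] by blast
  moreover from this have "degree f = k * degree F"
    using deg(1) unfolding p by (simp add: degree_power_eq F_neq_0 mult.commute)
  ultimately show ?thesis using p by (auto simp: iota_poly.hom_power)
qed

section \<open>Finite base fields\<close>

abbreviation "Fh \<equiv> map_poly \<iota> F"
abbreviation "sg \<equiv> map_poly \<sigma>"

section \<open>A twisted module structure modulo \<open>F\<close>\<close>

text \<open>The intended action of \<open>x\<close>; it is semilinear, as \<open>\<sigma>\<close> is
  applied to the coefficients of \<open>s\<close>.\<close>

definition twist :: "'l poly \<Rightarrow> 'l poly \<Rightarrow> 'l poly" where "twist c s = c * sg s"

text \<open>The action is defined on representatives; statements on the quotient by \<open>F\<close>
  become divisibility by \<open>Fh\<close>.\<close>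

definition act :: "'l poly \<Rightarrow> 'l poly \<Rightarrow> 'l poly \<Rightarrow> 'l poly" where
  "act c r s = (\<Sum>i\<le>degree r. Polynomial.smult (coeff r i) ((twist c ^^ i) s))"

lemma Fh_neq_0 [simp]: "Fh \<noteq> 0" using F_neq_0 by simp

lemma sg_Fh [simp]: "sg Fh = Fh"
  by (rule poly_eqI) (simp add: coeff_map_poly)

lemma sg_mod: "sg (p mod Fh) = sg p mod Fh"
  using map_poly_mod[of p Fh] by simp

lemma sg_funpow: "sg ^^ i = map_poly (\<sigma> ^^ i)"
proof (induction i)
  case 0
  show ?case by (rule ext) (simp add: poly_eq_iff coeff_map_poly)
next
  case (Suc i)
  then show ?case by (auto simp: fun_eq_iff map_poly_map_poly comp_def)
qed

lemma sg_funpow_n [simp]: "(sg ^^ n) p = p"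
  unfolding sg_funpow by (rule poly_eqI) (simp add: coeff_map_poly)

lemma sg_funpow_hom: "(sg ^^ i) (p * q) = (sg ^^ i) p * (sg ^^ i) q" "(sg ^^ i) 1 = 1"
  "(sg ^^ i) (p mod Fh) = (sg ^^ i) p mod Fh"
  by (induction i) (simp_all add: sigma_poly.hom_mult sg_mod)

lemma twist_funpow_add: "(twist c ^^ i) (s + s') = (twist c ^^ i) s + (twist c ^^ i) s'"
  by (induction i) (simp_all add: twist_def sigma_poly.hom_add ring_distribs)

lemma twist_funpow_smult: "(twist c ^^ i) (Polynomial.smult a s) = Polynomial.smult ((\<sigma> ^^ i) a) ((twist c ^^ i) s)"
  by (induction i) (simp_all add: twist_def map_poly_hom_smult)

lemma twist_funpow: "(twist c ^^ i) s = (\<Prod>j<i. (sg ^^ j) c) * (sg ^^ i) s"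
proof (induction i)
  case (Suc i)
  have "(twist c ^^ Suc i) s = c * (\<Prod>j<i. (sg ^^ Suc j) c) * (sg ^^ Suc i) s"
    by (simp add: Suc twist_def sigma_poly.hom_mult sigma_poly.hom_prod)
  also have "c * (\<Prod>j<i. (sg ^^ Suc j) c) = (\<Prod>j<Suc i. (sg ^^ j) c)"
    by (subst prod.lessThan_Suc_shift) simp
  finally show ?case .
qed simp

text \<open>The norm for the group generated by the coefficientwise \<open>\<sigma>\<close>; it is
  also the factor by which \<open>x\<^sup>n\<close> acts.\<close>

definition norm_poly :: "'l poly \<Rightarrow> 'l poly" where "norm_poly c = (\<Prod>j<n. (sg ^^ j) c)"

lemma twist_funpow_n: "(twist c ^^ n) s = norm_poly c * s"
  by (simp add: twist_funpow norm_poly_def)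

lemma twist_funpow_n_mult: "(twist c ^^ (n * i)) s = norm_poly c ^ i * s"
  by (induction i) (simp_all add: funpow_add twist_funpow_n)

lemma twist_funpow_dvd: "Fh dvd s \<Longrightarrow> Fh dvd (twist c ^^ i) s"
  by (induction i) (auto simp: twist_def elim!: dvdE simp: sigma_poly.hom_mult)

lemma act_bound: "degree r \<le> N \<Longrightarrow> act c r s = (\<Sum>i\<le>N. Polynomial.smult (coeff r i) ((twist c ^^ i) s))"
  unfolding act_def by (intro sum.mono_neutral_left) (auto simp: coeff_eq_0)

lemma act_add: "act c (p + q) s = act c p s + act c q s"
proof -
  define N where "N = max (degree p) (degree q)"
  have "degree (p + q) \<le> N" "degree p \<le> N" "degree q \<le> N"
    by (auto simp: N_def degree_add_le)
  then show ?thesis by (simp add: act_bound smult_add_left sum.distrib)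
qed

lemma act_add_right: "act c p (s + t) = act c p s + act c p t"
  by (simp add: act_def twist_funpow_add smult_add_right sum.distrib)

lemma act_monom: "act c (monom a i) s = Polynomial.smult a ((twist c ^^ i) s)"
proof -
  have "act c (monom a i) s = (\<Sum>j\<le>i. if i = j then Polynomial.smult a ((twist c ^^ i) s) else 0)"
    unfolding act_bound[OF degree_monom_le] by (intro sum.cong) auto
  then show ?thesis by simp
qed

lemma act_mult: "act c (p \<star> q) s = act c p (act c q s)"
proof (induction p rule: poly_monom_induct)
  case (monom a i)
  show ?case
    by (induction q rule: poly_monom_induct)
      (simp_all add: skew_mult_distrib skew_mult_monom act_add act_add_right act_monom
        funpow_add twist_funpow_smult twist_funpow_add smult_add_right)
qed (simp add: skew_mult_distrib act_add)

lemma act_dvd: "Fh dvd s \<Longrightarrow> Fh dvd act c r s"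
  unfolding act_def by (intro dvd_sum dvd_smult twist_funpow_dvd)

lemma act_Z: "act c (Z P) s = (map_poly \<iota> P \<circ>\<^sub>p norm_poly c) * s"
proof (induction P rule: poly_monom_induct)
  case (add P Q)
  then show ?case
    by (simp add: central_poly_eq_subst iota_poly.hom_add pcompose_add act_add ring_distribs)
next
  case (monom a i)
  have "monom b i \<circ>\<^sub>p w = Polynomial.smult b (w ^ i)" for b and w :: "'l poly"
    by (induction i) (simp_all add: monom_0 monom_Suc pcompose_pCons pcompose_smult)
  then show ?case
    by (simp add: central_poly_eq_subst map_poly_monom subst_monom act_monom twist_funpow_n_mult)
qed

lemma degree_mod_Fh: "degree (p mod Fh) < degree F"
  using degree_F_pos F_neq_0 degree_mod_less'[of Fh p] by (cases "p mod Fh = 0") auto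

text \<open>\<open>I\<close> is the annihilator of the class of \<open>1\<close>. It contains
  \<open>Z F\<close> because \<open>F\<close> of the norm is congruent to \<open>F(y)\<close>, and a
  relation among \<open>e + 1\<close> images of \<open>1\<close> gives an element of degree at most
  \<open>e\<close>. Its generator is a nonconstant divisor of \<open>Z F\<close>.\<close>

lemma degree_le_of_norm:
  assumes "Fh dvd norm_poly c - [:0, 1:]"
  shows "degree f \<le> degree F"
proof -
  define e where "e = degree F"
  define I where "I = {r. Fh dvd act c r 1}"
  define w where "w i = (twist c ^^ i) 1 mod Fh" for i
  have "degree (w i) < e" for i
    by (simp add: w_def e_def degree_mod_Fh)
  then obtain r where r: "r \<noteq> 0" "degree r \<le> e" "(\<Sum>i\<le>e. Polynomial.smult (coeff r i) (w i)) = 0"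
    using ex_linear_relation by metis
  have "act c r 1 = (\<Sum>i\<le>e. Polynomial.smult (coeff r i) ((twist c ^^ i) 1))"
    by (rule act_bound) (rule r(2))
  also have "\<dots> = (\<Sum>i\<le>e. Polynomial.smult (coeff r i) ((twist c ^^ i) 1 - w i))"
    using r(3) by (simp add: smult_diff_right sum_subtractf)
  also have "Fh dvd \<dots>"
    unfolding w_def by (intro dvd_sum dvd_smult dvd_minus_mod)
  finally have "r \<in> I" by (simp add: I_def)
  have "Fh dvd Fh \<circ>\<^sub>p norm_poly c - Fh"
    using assms dvd_pcompose_diff dvd_trans by blast
  then have "Fh dvd Fh \<circ>\<^sub>p norm_poly c" by (metis dvd_diff_left_iff dvd_refl)
  then have "Z F \<in> I" by (simp add: I_def act_Z)
  obtain d where d: "d \<in> I" "lead_coeff d = 1" "degree d \<le> degree r" "\<And>u. u \<in> I \<longleftrightarrow> (\<exists>q. u = q \<star> d)"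
  proof (rule left_ideal_principal[of r I])
    show "u + v \<in> I" if "u \<in> I" "v \<in> I" for u v using that by (simp add: I_def act_add)
    show "u \<star> v \<in> I" if "v \<in> I" for u v using that by (simp add: I_def act_mult act_dvd)
  qed (use \<open>r \<in> I\<close> r in auto)
  obtain q where q: "Z F = q \<star> d" using \<open>Z F \<in> I\<close> d(4) by blast
  have "degree d > 0"
  proof (rule ccontr)
    assume "\<not> degree d > 0"
    then have "d = 1" using d(2) by (auto elim!: degree_eq_zeroE simp: one_pCons)
    moreover have "act c 1 1 = 1" using act_monom[of c 1 0 1] by simp
    ultimately have "Fh dvd 1" using d(1) by (simp only: I_def mem_Collect_eq)
    then have "degree Fh = 0" using is_unit_iff_degree[OF Fh_neq_0] by blast
    then show False using degree_F_pos by simp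
  qed
  then show ?thesis using degree_le_divisor[OF q] d(3) r(2) e_def by linarith
qed

section \<open>The norm on the units modulo \<open>F\<close>\<close>

text \<open>Reduced representatives of the residue classes, packaged as a monoid so that
  \<open>units_of\<close> supplies the group.\<close>

definition residue_monoid :: "'l poly monoid" where
  "residue_monoid = \<lparr>carrier = {p. degree p < degree F}, monoid.mult = (\<lambda>p q. p * q mod Fh), one = 1\<rparr>"

lemma mod_Fh_self: "degree p < degree F \<Longrightarrow> p mod Fh = p"
  by (simp add: mod_poly_less)

lemma comm_monoid_residue: "comm_monoid residue_monoid"
  by (rule comm_monoidI)
    (auto simp: residue_monoid_def degree_mod_Fh mod_Fh_self mult.commute mult.left_commute mult.assoc mod_simps degree_F_pos)

lemma Units_residue: "Units residue_monoid = {p. degree p < degree F \<and> (\<exists>q. p * q mod Fh = 1)}"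
proof (intro equalityI subsetI)
  fix p assume "p \<in> {p. degree p < degree F \<and> (\<exists>q. p * q mod Fh = 1)}"
  then obtain q where "degree p < degree F" "p * q mod Fh = 1" by auto
  then have "p * (q mod Fh) mod Fh = 1" by (simp add: mod_simps)
  then show "p \<in> Units residue_monoid"
    using \<open>degree p < degree F\<close> degree_mod_Fh[of q]
    by (auto simp: Units_def residue_monoid_def mult.commute intro!: exI[of _ "q mod Fh"])
qed (auto simp: Units_def residue_monoid_def)

lemma one_mod_Fh [simp]: "1 mod Fh = 1" using degree_F_pos by (intro mod_Fh_self) simp

lemma norm_poly_mult: "norm_poly (p * q) = norm_poly p * norm_poly q"
  by (simp add: norm_poly_def sg_funpow_hom prod.distrib)

lemma norm_poly_mod: "norm_poly (p mod Fh) mod Fh = norm_poly p mod Fh"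
  by (simp add: norm_poly_def sg_funpow_hom mod_prod_eq)

lemma norm_poly_1: "norm_poly 1 = 1"
  by (simp add: norm_poly_def sg_funpow_hom)

lemma sg_norm_poly: "sg (norm_poly p) = norm_poly p"
proof -
  \<comment> \<open>The power \<open>n + 1\<close> of the twist is computed by splitting off the
    outermost or the innermost application; cancelling \<open>p\<close> leaves the
    invariance.\<close>
  have "p * sg (norm_poly p) = (twist p ^^ Suc n) 1"
    by (simp add: twist_def) (simp add: twist_funpow norm_poly_def sg_funpow_hom)
  also have "\<dots> = p * norm_poly p"
    by (simp add: funpow_Suc_right twist_funpow_n twist_def mult.commute del: funpow.simps)
  finally have "p * sg (norm_poly p) = p * norm_poly p" .
  moreover have "(sg ^^ j) 0 = 0" for j by (induction j) auto
  ultimately show ?thesis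
    using n_pos by (cases "p = 0") (simp_all add: norm_poly_def power_0_left)
qed

text \<open>The monic greatest common divisor of \<open>b\<close> and \<open>F\<close> is fixed by \<open>\<sigma>\<close>, hence is a divisor of \<open>F\<close> over
  the small field.\<close>

lemma sg_invariant_unit:
  assumes "b \<noteq> 0" "degree b < degree F" "Fh dvd s * b - sg b"
  shows "\<exists>q. b * q mod Fh = 1"
proof -
  interpret P: skew_poly "id :: 'l \<Rightarrow> 'l" by unfold_locales auto
  define I where "I = {p * b + q * Fh | p q. True}"
  have bI: "b \<in> I" and FI: "Fh \<in> I" unfolding I_def
    by (auto intro: exI[of _ 1] exI[of _ 0])
  have mult: "p * v \<in> I" if "v \<in> I" for p v
  proof -
    from that obtain r s where "v = r * b + s * Fh" by (auto simp: I_def)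
    then have "p * v = (p * r) * b + (p * s) * Fh" by (simp add: ring_distribs)
    then show ?thesis by (auto simp: I_def)
  qed
  have add: "u + v \<in> I" if "u \<in> I" "v \<in> I" for u v
  proof -
    from that obtain p q p' q' where "u = p * b + q * Fh" "v = p' * b + q' * Fh" by (auto simp: I_def)
    then have "u + v = (p + p') * b + (q + q') * Fh" by (simp add: ring_distribs)
    then show ?thesis by (auto simp: I_def)
  qed
  obtain d where d: "d \<in> I" "lead_coeff d = 1" "\<And>u. u \<in> I \<longleftrightarrow> (\<exists>q. u = q * d)"
    using P.left_ideal_principal[OF bI \<open>b \<noteq> 0\<close>, unfolded skew_mult_id, OF add mult] by metis
  have "sg b \<in> I"
  proof -
    obtain k where "s * b - sg b = Fh * k" using assms(3) by (elim dvdE)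
    then have "sg b = s * b + (- k) * Fh" by (simp add: algebra_simps)
    then show ?thesis unfolding I_def by blast
  qed
  obtain p q where pq: "d = p * b + q * Fh" using d(1) by (auto simp: I_def)
  \<comment> \<open>As \<open>sg b\<close> is congruent to \<open>s * b\<close>, the ideal contains
    \<open>sg d\<close>, so \<open>d\<close> divides it; both are monic of the same degree, hence
    equal.\<close>
  have "sg d = sg p * sg b + sg q * Fh"
    unfolding pq by (simp add: sigma_poly.hom_add sigma_poly.hom_mult)
  also have "\<dots> \<in> I" by (intro add mult FI \<open>sg b \<in> I\<close>)
  finally obtain k where k: "sg d = k * d" using d(3) by blast
  have "d \<noteq> 0" using d(2) by auto
  have "k \<noteq> 0" using k \<open>d \<noteq> 0\<close> by auto
  have "degree k = 0"
    using arg_cong[OF k, of degree] \<open>k \<noteq> 0\<close> \<open>d \<noteq> 0\<close> by (simp add: degree_mult_eq)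
  moreover have "lead_coeff k = 1"
    using arg_cong[OF k, of lead_coeff] d(2) by (simp add: lead_coeff_mult)
  ultimately have "k = 1" by (auto elim!: degree_eq_zeroE simp: one_pCons)
  then have "sg d = d" using k by simp
  then obtain D where D: "d = map_poly \<iota> D" using ex_map_poly_iota by blast
  have "d dvd Fh" using FI d(3) by auto
  then have "D dvd F" unfolding D by (rule iota.dvd_map_poly_hom_imp_dvd)
  then obtain E where E: "F = D * E" by (elim dvdE)
  have "degree d \<le> degree b"
    using bI d(3) assms(1) by (auto simp: degree_mult_eq)
  moreover have "D \<noteq> 0" "E \<noteq> 0" using E F_neq_0 by auto
  then have "degree F = degree D + degree E" by (simp add: E degree_mult_eq)
  ultimately have "degree d = 0" using F_irreducible[OF E] assms(2) D by auto
  then have "d = 1" using d(2) by (auto elim!: degree_eq_zeroE simp: one_pCons)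
  then have "b * p = 1 + (- q) * Fh" using pq by (simp add: algebra_simps)
  then have "b * p mod Fh = 1" by (simp only: mod_mult_self1 one_mod_Fh)
  then show ?thesis ..
qed

text \<open>The element \<open>b\<close> is the orbit sum of a constant \<open>a\<close> under \<open>s \<mapsto> c \<sigma>(s)\<close>, and \<open>a\<close> is chosen such that
  the constant coefficient of \<open>b\<close> is nonzero.\<close>

lemma hilbert_90:
  assumes c: "c * c' mod Fh = 1" and N: "norm_poly c mod Fh = 1"
  shows "\<exists>b. degree b < degree F \<and> (\<exists>q. b * q mod Fh = 1) \<and> b = c * sg b mod Fh"
proof -
  define w where "w i = (twist c ^^ i) 1 mod Fh" for i
  \<comment> \<open>Evaluating \<open>R\<close> at \<open>a\<close> gives the constant coefficient
    of \<open>b a\<close>. Since \<open>R\<close> is nonzero of degree less than \<open>n\<close>,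
    independence of the powers of \<open>\<sigma>\<close> provides \<open>a\<close>.\<close>
  define R where "R = (\<Sum>i<n. monom (coeff (w i) 0) i)"
  define b where "b a = (\<Sum>i<n. Polynomial.smult ((\<sigma> ^^ i) a) (w i))" for a
  have coeff_R: "coeff R i = (if i < n then coeff (w i) 0 else 0)" for i
    by (simp add: R_def coeff_sum)
  have "coeff R 0 = 1" using n_pos by (simp add: coeff_R w_def)
  then have "R \<noteq> 0" by auto
  have "degree R < n"
    using coeff_R n_pos \<open>R \<noteq> 0\<close> by (metis leading_coeff_0_iff)
  then obtain a where a: "skew_eval R a \<noteq> 0"
    using skew_eval_eq_0_imp_eq_0 \<open>R \<noteq> 0\<close> by blast
  have "skew_eval R a = coeff (b a) 0"
  proof -
    have "skew_eval R a = (\<Sum>i\<le>n - 1. coeff R i * (\<sigma> ^^ i) a)"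
      using \<open>degree R < n\<close> by (intro skew_eval_bound) simp
    also have "{..n - 1} = {..<n}" using n_pos by auto
    finally show ?thesis by (simp add: b_def coeff_sum coeff_R mult.commute)
  qed
  then have b0: "b a \<noteq> 0" using a by auto
  have deg: "degree (b a) < degree F"
    unfolding b_def using degree_F_pos degree_mod_Fh
    by (intro degree_sum_less) (auto simp: w_def intro: le_less_trans[OF degree_smult_le])
  have Tw: "Fh dvd c * sg (w i) - w (Suc i)" for i
  proof -
    have "(c * sg (w i)) mod Fh = w (Suc i) mod Fh"
      by (simp add: w_def sg_mod mod_mult_right_eq twist_def)
    then show ?thesis by (simp add: mod_eq_dvd_iff)
  qed
  \<comment> \<open>Norm one closes the orbit, so the twist permutes the summands of
    \<open>b a\<close> cyclically modulo \<open>F\<close>.\<close>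
  have wn: "w n = w 0" using N by (simp add: w_def twist_funpow_n)
  have "c * sg (b a) - b a = (\<Sum>i<n. Polynomial.smult ((\<sigma> ^^ Suc i) a) (c * sg (w i) - w (Suc i)))"
  proof -
    have "(\<Sum>i<n. Polynomial.smult ((\<sigma> ^^ Suc i) a) (w (Suc i))) = b a"
      using sum.lessThan_Suc_shift[of "\<lambda>i. Polynomial.smult ((\<sigma> ^^ i) a) (w i)" n]
      by (simp add: b_def wn)
    moreover have "c * sg (b a) = (\<Sum>i<n. Polynomial.smult ((\<sigma> ^^ Suc i) a) (c * sg (w i)))"
      by (simp add: b_def sigma_poly.hom_sum map_poly_hom_smult sum_distrib_left)
    ultimately show ?thesis by (simp add: smult_diff_right sum_subtractf)
  qed
  also have "Fh dvd \<dots>" by (intro dvd_sum dvd_smult Tw)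
  finally have fixed: "Fh dvd c * sg (b a) - b a" .
  then have "c * sg (b a) mod Fh = b a mod Fh" by (simp add: mod_eq_dvd_iff)
  then have eq: "b a = c * sg (b a) mod Fh" using mod_Fh_self[OF deg] by simp
  have "Fh dvd c' * b a - sg (b a)"
  proof -
    have "c' * b a mod Fh = (c * c' mod Fh) * sg (b a) mod Fh"
      by (subst eq) (simp add: mod_simps mult_ac)
    then show ?thesis using c by (simp add: mod_eq_dvd_iff)
  qed
  then show ?thesis using sg_invariant_unit[OF b0 deg] deg eq by blast
qed

lemma ex_norm_eq_y:
  assumes "finite (UNIV :: 'k set)"
  shows "\<exists>c. Fh dvd norm_poly c - [:0, 1:]"
proof -
  define G where "G = units_of residue_monoid"
  interpret R: comm_monoid residue_monoid by (rule comm_monoid_residue)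
  interpret G: comm_group G unfolding G_def by (rule R.units_comm_group)
  have G: "carrier G = {p. degree p < degree F \<and> (\<exists>q. p * q mod Fh = 1)}"
    "\<And>p q. p \<otimes>\<^bsub>G\<^esub> q = p * q mod Fh" "\<one>\<^bsub>G\<^esub> = 1"
    unfolding G_def units_of_carrier units_of_mult units_of_one Units_residue
    by (simp_all add: residue_monoid_def)
  define N where "N p = norm_poly p mod Fh" for p
  define t where "t = [:0, 1:] mod Fh"
  have "\<exists>c\<in>carrier G. N c = t"
  proof (rule G.norm_surjective)
    show "finite (carrier G)"
      using finite_degree_less[OF finite_extension_field[OF assms], of "degree F"] by (rule finite_subset[rotated]) (auto simp: G)
    show "sg \<in> hom G G"
    proof (rule homI)
      fix p assume "p \<in> carrier G"
      then obtain q where "degree p < degree F" "p * q mod Fh = 1" by (auto simp: G)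
      then have "sg p * sg q mod Fh = 1"
        using sg_mod[of "p * q"] by (simp add: sigma_poly.hom_mult)
      then show "sg p \<in> carrier G" using \<open>degree p < degree F\<close> by (auto simp: G)
    qed (simp add: G sg_mod sigma_poly.hom_mult)
    show "N \<in> hom G G"
    proof (rule homI)
      fix p assume "p \<in> carrier G"
      then obtain q where "p * q mod Fh = 1" by (auto simp: G)
      then have "N p * norm_poly q mod Fh = 1"
        using norm_poly_mod[of "p * q"] by (simp add: N_def norm_poly_mult norm_poly_1 mod_simps)
      then show "N p \<in> carrier G" by (auto simp: G N_def degree_mod_Fh)
    qed (simp add: G N_def norm_poly_mod norm_poly_mult mod_simps)
    show "sg (N u) = N u" for u by (simp add: N_def sg_mod sg_norm_poly)
    show "\<exists>b\<in>carrier G. b = c \<otimes>\<^bsub>G\<^esub> sg b" if c: "c \<in> carrier G" "N c = \<one>\<^bsub>G\<^esub>" for c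
      using c hilbert_90[of c] by (auto simp: G N_def)
    show "t \<in> carrier G"
    proof -
      \<comment> \<open>Writing \<open>F = F(0) + y H\<close> shows that \<open>- H / F(0)\<close>
        is an inverse of \<open>y\<close> modulo \<open>F\<close>.\<close>
      obtain H where H: "F = pCons (coeff F 0) H" by (cases F) auto
      have "[:0, 1:] * map_poly \<iota> H = Fh - [:\<iota> (coeff F 0):]"
        by (subst H) (simp add: poly_eq_iff coeff_map_poly coeff_pCons split: nat.splits)
      then have "[:0, 1:] * Polynomial.smult (- inverse (\<iota> (coeff F 0))) (map_poly \<iota> H)
          = 1 + Fh * [:- inverse (\<iota> (coeff F 0)):]"
        using coeff_F_0 by (simp add: smult_diff_right one_pCons)
      then have "t * Polynomial.smult (- inverse (\<iota> (coeff F 0))) (map_poly \<iota> H) mod Fh = 1"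
        unfolding t_def mod_mult_left_eq by (simp only: mod_mult_self2 one_mod_Fh)
      then show ?thesis unfolding G t_def using degree_mod_Fh by blast
    qed
    show "sg t = t" by (simp add: t_def sg_mod)
  qed
  then show ?thesis by (auto simp: N_def t_def mod_eq_dvd_iff)
qed

end

theorem mainTheorem1:
  fixes \<iota> :: "'k::field \<Rightarrow> 'l::field"
    and n m h :: nat
    and \<sigma> :: "'l \<Rightarrow> 'l"
    and f :: "'l poly"
    and F :: "'k poly"
  assumes "n \<ge> 2"
    and "cyclic_galois_extension \<iota> n \<sigma>"
    and "skew_irreducible \<sigma> f"
    and "lead_coeff f = 1"
    and "degree f = h"
    and "coeff f 0 \<noteq> 0"
    and "is_bound \<iota> n \<sigma> f F"
    and "skew_num_irreducible_factors \<sigma> (central_poly \<iota> n F) m"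
  shows "matrix_of_map h (phi \<sigma> f ^^ n) = A_mat n \<sigma> f \<and>
    map_poly \<iota> (min_poly (\<lambda>c v. Polynomial.smult (\<iota> c) v) (skew_remainders f) (phi \<sigma> f ^^ n))
      = min_poly Polynomial.smult (skew_remainders f) (phi \<sigma> f ^^ n) \<and>
    m dvd n \<and>
    char_poly (A_mat n \<sigma> f) = map_poly \<iota> F ^ (n div m) \<and>
    (finite (UNIV :: 'k set) \<longrightarrow> n div m = 1)"
proof -
  interpret irreducible_with_bound \<iota> n \<sigma> f F
    using assms by unfold_locales auto
  obtain k where k: "char_poly (A_mat n \<sigma> f) = map_poly \<iota> F ^ k" "degree f = k * degree F"
    using char_poly_A_eq_power by blast
  \<comment> \<open>Both relations between \<open>degree f\<close> and \<open>degree F\<close>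
    combine to \<open>n = m k\<close>, which identifies the exponent \<open>k\<close> with
    \<open>n div m\<close>.\<close>
  have "m * (k * degree F) = n * degree F"
    using num_factors_degree[OF assms(8)] k(2) by simp
  then have n: "n = m * k" using degree_F_pos by simp
  with n_pos have "m > 0" "k > 0" by auto
  have nm: "n div m = k" and dvd: "m dvd n" using n \<open>m > 0\<close> by simp_all
  have "k = 1" if "finite (UNIV :: 'k set)"
  proof -
    have "k * degree F \<le> degree F"
      using ex_norm_eq_y[OF that] degree_le_of_norm k(2) by auto
    then show ?thesis using degree_F_pos \<open>k > 0\<close> by simp
  qed
  then show ?thesis
    using matrix_of_phi_funpow min_poly_phi min_poly_phi_iota k(1) nm dvd assms(5) by simp
qed

end
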